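(* Let $m\ge2$, $h_1,\dots,h_m\in\{x_1,\dots,x_n\}$, and assume $p_{h_1,h_1}\neq1$ in case $\mu(h_1\cdots h_m)=\{h_1\}$. Then: (a) If either ($h_1\cdots h_{m-1}\in\mathfrak{L}(V)$ and $h_1\cdots h_{m-1}\diamond h_m$) or ($h_2\cdots h_m\in\mathfrak{L}(V)$ and $h_2\cdots h_m\diamond h_1$), then $h_1h_2\cdots h_m\in\mathfrak{L}(V)$. (b) If $0\neq h_1\cdots h_m\in\mathfrak{L}(V)$, then there is $\tau\in\mathbb{S}_m$ with $h_1\cdots h_m\sim h_{\tau(1)}\cdots h_{\tau(m)}$ such that either $0\neq h_{\tau(1)}\cdots h_{\tau(m-1)}\in\mathfrak{L}(V)$ and $h_{\tau(1)}\cdots h_{\tau(m-1)}\diamond h_{\tau(m)}$, or $0\neq h_{\tau(2)}\cdots h_{\tau(m)}\in\mathfrak{L}(V)$ and $h_{\tau(2)}\cdots h_{\tau(m)}\diamond h_{\tau(1)}$. (c) If the monomial $h_1\cdots h_m$ is connected, then $h_1\cdots h_m\in\mathfrak{L}(V)$.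
   Context: $V$ is a braided vector space of diagonal type over an algebraically closed field $F$ of characteristic $0$, with basis $x_1,\dots,x_n$, braiding $C(x_i\otimes x_j)=q_{ij}x_j\otimes x_i$, Nichols algebra $\mathfrak{B}(V)$ ($\mathbb{Z}^n$-graded, $\deg x_i=e_i$). $\chi$ is the bicharacter with $\chi(e_i,e_j)=q_{ij}$, $p_{ij}:=q_{ij}$, $p_{uv}:=\chi(\deg u,\deg v)$ for homogeneous $u,v$, $\tilde p_{x_i,x_j}:=p_{ij}p_{ji}$. For homogeneous $x,y$, $[x,y]:=yx-p_{yx}xy$, and $\mathfrak{L}(V)$ is the linear span in $\mathfrak{B}(V)$ of all iterated brackets (any bracketing) of $x_1,\dots,x_n$. A monomial is a word $h_1\cdots h_m$ in the letters $x_1,\dots,x_n$, also regarded as an element of $\mathfrak{B}(V)$; $\mu(\cdot)$ is its set of letters. $\Gamma(V)$ has vertices $1,\dots,n$ and edge $\{i,j\}$ ($i\ne j$) iff $p_{ij}p_{ji}\ne1$; a monomial is connected iff the subgraph of $\Gamma(V)$ induced on its letters is connected (a single vertex is connected). For monomials $v,w$, $v\diamond w$ means there exist $x_i\in\mu(v),x_j\in\mu(w)$ with $\tilde p_{x_i,x_j}\ne1$. $u\sim v$ means $u=av$ for some $a\in F^*$. *)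

theory Defs
  imports "HOL-Computational_Algebra.Polynomial" "HOL-Library.Multiset"
    "HOL-Combinatorics.Permutations"
begin

text \<open>Letters x_0,...,x_{n-1} are encoded by natural numbers i < n.
  Elements of the tensor algebra T(V) are represented as coefficient functions
  from words (nat lists) to the field.  The braiding matrix is q i j = q_ij.\<close>

type_synonym 'a tens = "nat list \<Rightarrow> 'a"

definition letter :: "nat \<Rightarrow> 'a::field tens" where
  "letter i = (\<lambda>w. if w = [i] then 1 else 0)"

definition wordt :: "nat list \<Rightarrow> 'a::field tens" where
  "wordt hs = (\<lambda>w. if w = hs then 1 else 0)"

text \<open>concatenation product of T(V)\<close>
definition tmult :: "'a::field tens \<Rightarrow> 'a tens \<Rightarrow> 'a tens" where
  "tmult u v = (\<lambda>w. \<Sum>k\<le>length w. u (take k w) * v (drop k w))"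

text \<open>bicharacter chi on Z^n-degrees, degrees represented as multisets of letters\<close>
definition chi :: "(nat \<Rightarrow> nat \<Rightarrow> 'a::field) \<Rightarrow> nat multiset \<Rightarrow> nat multiset \<Rightarrow> 'a" where
  "chi q A B = (\<Prod>i\<in>#A. \<Prod>j\<in>#B. q i j)"

text \<open>bracketing trees (iterated brackets of letters)\<close>
datatype btree = Leaf nat | Node btree btree

fun leaves :: "btree \<Rightarrow> nat multiset" where
  "leaves (Leaf i) = {#i#}"
| "leaves (Node a b) = leaves a + leaves b"

text \<open>[x,y] = yx - p_{yx} xy\<close>
fun bval :: "(nat \<Rightarrow> nat \<Rightarrow> 'a::field) \<Rightarrow> btree \<Rightarrow> 'a tens" where
  "bval q (Leaf i) = letter i"
| "bval q (Node a b) =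
     (\<lambda>w. tmult (bval q b) (bval q a) w
          - chi q (leaves b) (leaves a) * tmult (bval q a) (bval q b) w)"

text \<open>Iterated skew derivations: dpair q s w is the scalar obtained by applying
  the skew derivations d_{s_1}, d_{s_2}, ... (d_{s_1} first) to the word w, where
  d_i(x_{j_1}...x_{j_m}) = sum over k with j_k = i of
     (prod_{l>k} q_{i j_l}) x_{j_1}..(omit k)..x_{j_m}.
  These derivations arise from the factorisation of the quantum symmetrizer of the
  braiding c(x_i \<otimes> x_j) = q_ij x_j \<otimes> x_i.\<close>
fun dpair :: "(nat \<Rightarrow> nat \<Rightarrow> 'a::field) \<Rightarrow> nat list \<Rightarrow> nat list \<Rightarrow> 'a" where
  "dpair q [] w = (if w = [] then 1 else 0)"
| "dpair q (i # s) w =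
     (\<Sum>k\<in>{k. k < length w \<and> w ! k = i}.
        (\<Prod>l\<in>{k<..<length w}. q i (w ! l)) * dpair q s (take k w @ drop (Suc k) w))"

text \<open>u represents 0 in the Nichols algebra B(V) = T(V)/I, where I is the kernel of
  the quantum symmetrizer, i.e. all iterated derivations of every homogeneous
  component vanish.\<close>
definition nichols_zero :: "(nat \<Rightarrow> nat \<Rightarrow> 'a::field) \<Rightarrow> 'a tens \<Rightarrow> bool" where
  "nichols_zero q u \<longleftrightarrow>
     (\<forall>s. (\<Sum>w\<in>{w. mset w = mset s}. u w * dpair q s w) = 0)"

text \<open>u lies in L(V): modulo I it is a linear combination of iterated brackets of
  x_1..x_n\<close>
definition in_L :: "nat \<Rightarrow> (nat \<Rightarrow> nat \<Rightarrow> 'a::field) \<Rightarrow> 'a tens \<Rightarrow> bool" where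
  "in_L n q u \<longleftrightarrow>
     (\<exists>T c. finite T \<and> (\<forall>t\<in>T. set_mset (leaves t) \<subseteq> {..<n}) \<and>
        nichols_zero q (\<lambda>w. u w - (\<Sum>t\<in>T. c t * bval q t w)))"

text \<open>u \<sim> v in B(V)\<close>
definition nsim :: "(nat \<Rightarrow> nat \<Rightarrow> 'a::field) \<Rightarrow> 'a tens \<Rightarrow> 'a tens \<Rightarrow> bool" where
  "nsim q u v \<longleftrightarrow> (\<exists>a. a \<noteq> 0 \<and> nichols_zero q (\<lambda>w. u w - a * v w))"

text \<open>v \<diamond> w for monomials (given as letter lists)\<close>
definition diam :: "(nat \<Rightarrow> nat \<Rightarrow> 'a::field) \<Rightarrow> nat list \<Rightarrow> nat list \<Rightarrow> bool" where
  "diam q v w \<longleftrightarrow> (\<exists>i\<in>set v. \<exists>j\<in>set w. q i j * q j i \<noteq> 1)"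

text \<open>edges of the graph Gamma(V)\<close>
definition gamma_edges :: "nat \<Rightarrow> (nat \<Rightarrow> nat \<Rightarrow> 'a::field) \<Rightarrow> (nat \<times> nat) set" where
  "gamma_edges n q = {(i, j). i < n \<and> j < n \<and> i \<noteq> j \<and> q i j * q j i \<noteq> 1}"

text \<open>a monomial is connected iff the induced subgraph on its letters is connected\<close>
definition connected_mon :: "nat \<Rightarrow> (nat \<Rightarrow> nat \<Rightarrow> 'a::field) \<Rightarrow> nat list \<Rightarrow> bool" where
  "connected_mon n q hs \<longleftrightarrow>
     (\<forall>i\<in>set hs. \<forall>j\<in>set hs.
        (i, j) \<in> (gamma_edges n q \<inter> (set hs \<times> set hs))\<^sup>*)"

end

(*
  For homogeneous u, v in L(V) the key fact is: if some letter of u and some letter of v have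
  p_ij p_ji \<noteq> 1, then uv lies in L(V). Modulo L(V) one has vu = p_{vu} uv, so moving the three
  factors of a product uvw around cyclically in two different ways kills uvw as soon as
  p_{vw} p_{wv} \<noteq> 1 and all cyclically adjacent products lie in L(V); this settles the products
  b a x in which b and x are letters. The general case follows by induction on the
  degree, expanding a factor as a bracket and using that factors without such a pair of letters
  commute up to a scalar in the Nichols algebra. In particular a nonzero element of L(V) has
  connected support; conversely a connected monomial is built up from one of its letters by
  adjoining adjacent letters on the left or on the right.
*)

theory Submission
  imports Defs "HOL-Combinatorics.Multiset_Permutations"
begin

text \<open>The obstacle is that adjacency of two degrees B, C does not give p_{BC} p_{CB} \<noteq>
  1: this scalar is a product over all pairs of letters, and factors different from 1 may cancel.
  Only for two single letters are the two conditions the same. Hence the cyclic argument is applied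
  with two letters and an arbitrary third factor, and an induction over brackets carries the result
  to other factors. In that induction a bracket [c,d] is split into its two products only if each of
  c and d is adjacent to one of the remaining factors; otherwise it is treated as a whole. The
  quotient B(V) is never formed. Elements stay in T(V), and homogeneity, membership in L(V) and
  equality up to a scalar are all made stable under adding elements of the ideal. The ideal itself
  is accessible through skew derivations: it consists of the elements all of whose iterated
  derivatives have zero constant term. A letter counts as adjacent to itself if p_ii^2 \<noteq> 1.
  For powers of one letter the hypothesis on p_ii leaves, besides this, only p_ii = -1, where x_i^2
  = 0.\<close>

notation tmult (infixr "\<cdot>" 70)

subsection \<open>The tensor algebra\<close>

lemma tmult_Nil: "(u \<cdot> v) [] = u [] * v []"
  by (simp add: tmult_def)

lemma tmult_Cons: "(u \<cdot> v) (i # w) = u [] * v (i # w) + ((\<lambda>z. u (i # z)) \<cdot> v) w"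
  unfolding tmult_def by (simp add: sum.atMost_Suc_shift del: sum.atMost_Suc)

lemma tmult_add_left: "(\<lambda>w. u w + c * u' w) \<cdot> v = (\<lambda>w. (u \<cdot> v) w + c * (u' \<cdot> v) w)"
  by (simp add: tmult_def fun_eq_iff algebra_simps sum.distrib sum_distrib_left)

lemma tmult_add_right: "v \<cdot> (\<lambda>w. u w + c * u' w) = (\<lambda>w. (v \<cdot> u) w + c * (v \<cdot> u') w)"
  by (simp add: tmult_def fun_eq_iff algebra_simps sum.distrib sum_distrib_left)

lemma tmult_diff_left: "(\<lambda>w. u w - c * u' w) \<cdot> v = (\<lambda>w. (u \<cdot> v) w - c * (u' \<cdot> v) w)"
  by (simp add: tmult_def fun_eq_iff algebra_simps sum_subtractf sum_distrib_left)

lemma tmult_diff_right: "v \<cdot> (\<lambda>w. u w - c * u' w) = (\<lambda>w. (v \<cdot> u) w - c * (v \<cdot> u') w)"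
  by (simp add: tmult_def fun_eq_iff algebra_simps sum_subtractf sum_distrib_left)

lemma tmult_zero_left [simp]: "(\<lambda>w. 0) \<cdot> v = (\<lambda>w. 0)"
  and tmult_zero_right [simp]: "v \<cdot> (\<lambda>w. 0) = (\<lambda>w. 0)"
  by (simp_all add: tmult_def)

lemma tmult_sum_left: "(\<lambda>w. \<Sum>t\<in>T. c t * f t w) \<cdot> v = (\<lambda>w. \<Sum>t\<in>T. c t * (f t \<cdot> v) w)"
proof (induction T rule: infinite_finite_induct)
  case (insert t T)
  have "(\<lambda>w. \<Sum>t\<in>insert t T. c t * f t w) = (\<lambda>w. (\<Sum>t\<in>T. c t * f t w) + c t * f t w)"
    using insert.hyps by (simp add: add.commute)
  then show ?case
    using insert by (simp only: tmult_add_left) (simp add: add.commute)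
qed simp_all

lemma tmult_sum_right: "v \<cdot> (\<lambda>w. \<Sum>t\<in>T. c t * f t w) = (\<lambda>w. \<Sum>t\<in>T. c t * (v \<cdot> f t) w)"
proof (induction T rule: infinite_finite_induct)
  case (insert t T)
  have "(\<lambda>w. \<Sum>t\<in>insert t T. c t * f t w) = (\<lambda>w. (\<Sum>t\<in>T. c t * f t w) + c t * f t w)"
    using insert.hyps by (simp add: add.commute)
  then show ?case
    using insert by (simp only: tmult_add_right) (simp add: add.commute)
qed simp_all

lemma tmult_assoc: "(u \<cdot> v) \<cdot> z = u \<cdot> v \<cdot> z"
proof
  show "((u \<cdot> v) \<cdot> z) w = (u \<cdot> v \<cdot> z) w" for w
  proof (induction w arbitrary: u)
    case (Cons i w)
    have "((\<lambda>x. (u \<cdot> v) (i # x)) \<cdot> z) w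
        = u [] * ((\<lambda>x. v (i # x)) \<cdot> z) w + (((\<lambda>x. u (i # x)) \<cdot> v) \<cdot> z) w"
      using fun_cong[OF tmult_add_left[of "\<lambda>x. ((\<lambda>y. u (i # y)) \<cdot> v) x" "u []" "\<lambda>x. v (i # x)" z], of w]
      by (simp add: tmult_Cons add.commute)
    then show ?case
      by (simp add: tmult_Cons tmult_Nil Cons.IH algebra_simps)
  qed (simp add: tmult_Nil)
qed

lemma wordt_Nil_left [simp]: "wordt [] \<cdot> v = v"
proof
  show "(wordt [] \<cdot> v) w = v w" for w
    by (cases w) (simp_all add: tmult_Cons tmult_Nil wordt_def)
qed

lemma wordt_mult: "wordt u \<cdot> wordt v = (wordt (u @ v) :: 'a::field tens)"
proof
  show "(wordt u \<cdot> wordt v) w = (wordt (u @ v) w :: 'a)" for w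
  proof (induction u arbitrary: w)
    case (Cons i u)
    show ?case
    proof (cases w)
      case (Cons j w')
      have "(\<lambda>z. wordt (i # u) (j # z)) = (if i = j then wordt u else (\<lambda>z. 0) :: 'a tens)"
        by (auto simp: wordt_def)
      then show ?thesis
        using Cons.IH[of w'] by (simp add: Cons tmult_Cons) (simp add: wordt_def)
    qed (simp add: tmult_Nil wordt_def)
  qed simp
qed

lemma wordt_Nil_right [simp]: "v \<cdot> wordt [] = v"
proof
  show "(v \<cdot> wordt []) w = v w" for w
    by (induction w arbitrary: v) (simp_all add: tmult_Cons tmult_Nil wordt_def)
qed

lemma letter_eq_wordt: "letter i = wordt [i]"
  by (simp add: letter_def wordt_def)

subsection \<open>Skew derivations and the Nichols ideal\<close>

text \<open>The derivation d_i in terms of coefficients: the value at w collects all words from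
  which removing one letter i gives w. The recursion peels off the first letter just as
  \<open>tmult_Cons\<close> does, which is what makes inductions on words work.\<close>

fun skew :: "(nat \<Rightarrow> nat \<Rightarrow> 'a::field) \<Rightarrow> nat \<Rightarrow> 'a tens \<Rightarrow> 'a tens" where
  "skew q i u [] = u [i]"
| "skew q i u (j # w) = prod_list (map (q i) (j # w)) * u (i # j # w) + skew q i (\<lambda>z. u (j # z)) w"

text \<open>The algebra automorphism x_j -> q_ij x_j, that is, the action of the group-like element
  accompanying d_i.\<close>

definition grading_twist :: "(nat \<Rightarrow> nat \<Rightarrow> 'a::field) \<Rightarrow> nat \<Rightarrow> 'a tens \<Rightarrow> 'a tens" where
  "grading_twist q i u = (\<lambda>w. prod_list (map (q i) w) * u w)"

lemma skew_sum:
  "skew q i u w = (\<Sum>k\<le>length w. prod_list (map (q i) (drop k w)) * u (take k w @ i # drop k w))"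
  by (induction w arbitrary: u) (simp_all add: sum.atMost_Suc_shift del: sum.atMost_Suc)

lemma skew_add: "skew q i (\<lambda>w. u w + c * v w) = (\<lambda>w. skew q i u w + c * skew q i v w)"
  by (simp add: skew_sum fun_eq_iff algebra_simps sum.distrib sum_distrib_left)

lemma skew_zero [simp]: "skew q i (\<lambda>w. 0) = (\<lambda>w. 0)"
  by (simp add: skew_sum fun_eq_iff)

lemma grading_twist_tmult:
  "grading_twist q i u \<cdot> grading_twist q i v = grading_twist q i (u \<cdot> v)"
proof
  fix w
  have "prod_list (map (q i) (take k w)) * u (take k w)
        * (prod_list (map (q i) (drop k w)) * v (drop k w))
      = prod_list (map (q i) w) * (u (take k w) * v (drop k w))" for k
  proof -
    have "prod_list (map (q i) w) = prod_list (map (q i) (take k w)) * prod_list (map (q i) (drop k w))"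
      by (metis append_take_drop_id map_append prod_list.append)
    then show ?thesis by (simp add: mult_ac)
  qed
  then show "(grading_twist q i u \<cdot> grading_twist q i v) w = grading_twist q i (u \<cdot> v) w"
    by (simp only: grading_twist_def tmult_def sum_distrib_left)
qed

lemma skew_grading_twist:
  "skew q j (grading_twist q i u) = (\<lambda>w. q i j * grading_twist q i (skew q j u) w)"
proof
  fix w
  have "prod_list (map (q i) (take k w)) * (q i j * prod_list (map (q i) (drop k w)))
      = q i j * prod_list (map (q i) w)" for k
    by (metis append_take_drop_id map_append prod_list.append mult.left_commute)
  then have *: "prod_list (map (q i) (take k w @ j # drop k w)) = q i j * prod_list (map (q i) w)" for k
    by simp
  show "skew q j (grading_twist q i u) w = q i j * grading_twist q i (skew q j u) w"
    unfolding skew_sum grading_twist_def *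
    by (simp add: sum_distrib_left mult_ac)
qed

text \<open>The scalar in d_i runs over the letters to the right of the removed one, so removing a
  letter from the left factor also twists the whole right factor. This is the Leibniz rule of a skew
  derivation.\<close>

lemma skew_tmult:
  "skew q i (u \<cdot> v) = (\<lambda>w. (u \<cdot> skew q i v) w + (skew q i u \<cdot> grading_twist q i v) w)"
proof
  show "skew q i (u \<cdot> v) w = (u \<cdot> skew q i v) w + (skew q i u \<cdot> grading_twist q i v) w" for w
  proof (induction w arbitrary: u)
    case Nil
    then show ?case by (simp add: tmult_Nil tmult_Cons grading_twist_def)
  next
    case (Cons j w)
    let ?Q = "prod_list (map (q i) w)"
    have 1: "skew q i (\<lambda>z. (u \<cdot> v) (j # z)) w
        = skew q i ((\<lambda>z. u (j # z)) \<cdot> v) w + u [] * skew q i (\<lambda>z. v (j # z)) w"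
      using fun_cong[OF skew_add[of q i "(\<lambda>z. u (j # z)) \<cdot> v" "u []" "\<lambda>z. v (j # z)"], of w]
      by (simp add: tmult_Cons add.commute)
    have 2: "((\<lambda>z. skew q i u (j # z)) \<cdot> grading_twist q i v) w
       = (skew q i (\<lambda>z. u (j # z)) \<cdot> grading_twist q i v) w
         + q i j * (?Q * ((\<lambda>z. u (i # j # z)) \<cdot> v) w)"
    proof -
      have "(\<lambda>z. skew q i u (j # z))
         = (\<lambda>z. skew q i (\<lambda>z. u (j # z)) z + q i j * grading_twist q i (\<lambda>z. u (i # j # z)) z)"
        by (simp add: fun_eq_iff grading_twist_def mult_ac)
      then show ?thesis
        by (simp only: tmult_add_left grading_twist_tmult) (simp add: grading_twist_def)
    qed
    have 3: "(u \<cdot> v) (i # j # w) = u [] * v (i # j # w) + u [i] * v (j # w)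
        + ((\<lambda>z. u (i # j # z)) \<cdot> v) w"
      by (simp add: tmult_Cons)
    have 4: "(u \<cdot> skew q i v) (j # w) = u [] * (q i j * ?Q * v (i # j # w))
        + u [] * skew q i (\<lambda>z. v (j # z)) w + ((\<lambda>z. u (j # z)) \<cdot> skew q i v) w"
      by (simp add: tmult_Cons algebra_simps)
    have 5: "(skew q i u \<cdot> grading_twist q i v) (j # w) = u [i] * (q i j * ?Q * v (j # w))
        + ((\<lambda>z. skew q i u (j # z)) \<cdot> grading_twist q i v) w"
      by (simp add: tmult_Cons grading_twist_def)
    show ?case
      unfolding skew.simps(2)[of q i "u \<cdot> v"] 1 Cons.IH 3 4 5 2
      by (simp add: algebra_simps)
  qed
qed

fun skews :: "(nat \<Rightarrow> nat \<Rightarrow> 'a::field) \<Rightarrow> nat list \<Rightarrow> 'a tens \<Rightarrow> 'a tens" where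
  "skews q [] u = u"
| "skews q (i # s) u = skews q s (skew q i u)"

lemma finite_mset_eq: "finite {w. mset w = M}"
  using finite_permutations_of_multiset[of M] by (simp add: permutations_of_multiset_def)

text \<open>Moves the derivations from words to coefficient functions: the pairing with s becomes a
  constant term, to which the Leibniz rule can be applied one letter of s at a time.\<close>

lemma sum_dpair_eq_skews:
  "(\<Sum>w | mset w = mset s. u w * dpair q s w) = skews q s u []"
proof (induction s arbitrary: u)
  case Nil
  then show ?case by simp
next
  case (Cons i s)
  let ?g = "\<lambda>w k. prod_list (map (q i) (drop k w))"
  have tail: "(\<Prod>l\<in>{k<..<length w}. q i (w ! l)) = prod_list (map (q i) (drop (Suc k) w))" for k w
  proof -
    have "prod_list (map (q i) (drop (Suc k) w)) = (\<Prod>l\<in>{0..<length w - Suc k}. q i (w ! (Suc k + l)))"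
      by (subst prod.list_conv_set_nth) (simp add: add_ac)
    also have "\<dots> = (\<Prod>l\<in>{k<..<length w}. q i (w ! l))"
      by (rule prod.reindex_bij_witness[of _ "\<lambda>l. l - Suc k" "\<lambda>l. Suc k + l"]) auto
    finally show ?thesis by simp
  qed
  have "(\<Sum>w | mset w = mset (i # s). u w * dpair q (i # s) w)
     = (\<Sum>w | mset w = mset (i # s). \<Sum>k | k < length w \<and> w ! k = i.
          u w * (prod_list (map (q i) (drop (Suc k) w)) * dpair q s (take k w @ drop (Suc k) w)))"
    by (simp add: sum_distrib_left tail)
  also have "\<dots> = (\<Sum>(w, k)\<in>(SIGMA w:{w. mset w = mset (i # s)}. {k. k < length w \<and> w ! k = i}).
          u w * (prod_list (map (q i) (drop (Suc k) w)) * dpair q s (take k w @ drop (Suc k) w)))"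
    by (rule sum.Sigma) (auto simp: finite_mset_eq simp del: mset.simps)
  also have "\<dots> = (\<Sum>(w, k)\<in>(SIGMA w:{w. mset w = mset s}. {..length w}).
          u (take k w @ i # drop k w) * (?g w k * dpair q s w))"
  \<comment> \<open>A word with a marked letter i corresponds to the shorter word with a marked gap;
    a word of length l has l + 1 gaps, hence the range \<open>{..length w}\<close>.\<close>
  proof (rule sum.reindex_bij_witness[of _
        "\<lambda>(w, k). (take k w @ i # drop k w, k)" "\<lambda>(w, k). (take k w @ drop (Suc k) w, k)"], goal_cases)
    case (1 a)
    then show ?case by (auto simp: id_take_nth_drop[symmetric])
  next
    case (2 a)
    obtain w k where a: "a = (w, k)" by force
    with 2 have k: "k < length w" "w ! k = i" and w: "mset w = mset (i # s)" by auto
    have "mset w = mset (take k w @ w ! k # drop (Suc k) w)"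
      using id_take_nth_drop[OF k(1)] by simp
    then have "mset (take k w @ drop (Suc k) w) = mset s"
      using k(2) w by simp
    then show ?case using a k by auto
  next
    case (3 b)
    then show ?case by (auto simp: min_def)
  next
    case (4 b)
    obtain w k where b: "b = (w, k)" by force
    with 4 have k: "k \<le> length w" and w: "mset w = mset s" by auto
    have "mset (take k w @ i # drop k w) = mset (i # s)"
      using w by (metis append_take_drop_id mset.simps(2) mset_append union_mset_add_mset_right)
    then show ?case using b k by (auto simp: nth_append)
  next
    case (5 a)
    then show ?case by (auto simp: id_take_nth_drop[symmetric] min_def)
  qed
  also have "\<dots> = (\<Sum>w | mset w = mset s. skew q i u w * dpair q s w)"
    by (subst sum.Sigma[symmetric]) (auto simp: finite_mset_eq skew_sum sum_distrib_left sum_distrib_right mult_ac)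
  finally show ?case using Cons.IH[of "skew q i u"] by simp
qed

lemma nichols_zero_skews: "nichols_zero q u \<longleftrightarrow> (\<forall>s. skews q s u [] = 0)"
  unfolding nichols_zero_def sum_dpair_eq_skews ..

lemma nichols_zero_rec:
  "nichols_zero q u \<longleftrightarrow> u [] = 0 \<and> (\<forall>i. nichols_zero q (skew q i u))"
  unfolding nichols_zero_skews by (metis list.exhaust skews.simps)

lemma skews_add: "skews q s (\<lambda>w. u w + c * v w) = (\<lambda>w. skews q s u w + c * skews q s v w)"
  by (induction s arbitrary: u v) (simp_all add: skew_add)

lemma nichols_zero_add:
  "nichols_zero q u \<Longrightarrow> nichols_zero q v \<Longrightarrow> nichols_zero q (\<lambda>w. u w + c * v w)"
  by (simp add: nichols_zero_skews skews_add)

lemma nichols_zero_0 [simp]: "nichols_zero q (\<lambda>w. 0)"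
  by (simp add: nichols_zero_def)

lemma nichols_zero_scale: "nichols_zero q u \<Longrightarrow> nichols_zero q (\<lambda>w. c * u w)"
  using nichols_zero_add[of q "\<lambda>w. 0" u c] by simp

lemma nichols_zero_diff:
  "nichols_zero q u \<Longrightarrow> nichols_zero q v \<Longrightarrow> nichols_zero q (\<lambda>w. u w - c * v w)"
  using nichols_zero_add[of q u v "-c"] by simp

text \<open>Twist and derivations commute up to scalars, so vanishing of iterated derivatives is
  preserved. The twisted right factor in the Leibniz rule calls for this.\<close>

lemma nichols_zero_grading_twist: "nichols_zero q u \<Longrightarrow> nichols_zero q (grading_twist q i u)"
proof -
  have "skews q s (grading_twist q i u) [] = 0" if "nichols_zero q u" for s
    using that
  proof (induction s arbitrary: u)
    case Nil
    then show ?case by (simp add: grading_twist_def nichols_zero_rec[of q u])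
  next
    case (Cons j s)
    have "skews q s (grading_twist q i (skew q j u)) [] = 0"
      using Cons nichols_zero_rec by blast
    then show ?case
      using fun_cong[OF skews_add[of q s "\<lambda>w. 0" "q i j" "grading_twist q i (skew q j u)"], of "[]"]
        nichols_zero_0[of q, unfolded nichols_zero_skews]
      by (simp add: skew_grading_twist)
  qed
  then show "nichols_zero q u \<Longrightarrow> ?thesis" by (simp add: nichols_zero_skews)
qed

text \<open>Each of the two Leibniz terms again has a null factor, on the same side as before. With
  the disjunction as hypothesis the induction on s treats left and right ideal at once.\<close>

lemma nichols_zero_tmult:
  assumes "nichols_zero q u \<or> nichols_zero q v"
  shows "nichols_zero q (u \<cdot> v)"
proof -
  have "skews q s (u \<cdot> v) [] = 0" for s
    using assms
  proof (induction s arbitrary: u v)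
    case Nil
    then show ?case by (auto simp: nichols_zero_rec[of q u] nichols_zero_rec[of q v] tmult_Nil)
  next
    case (Cons i s)
    have "nichols_zero q u \<or> nichols_zero q (skew q i v)"
      "nichols_zero q (skew q i u) \<or> nichols_zero q (grading_twist q i v)"
      using Cons.prems nichols_zero_rec nichols_zero_grading_twist by blast+
    from this[THEN Cons.IH] show ?case
      using fun_cong[OF skews_add[of q s "u \<cdot> skew q i v" 1 "skew q i u \<cdot> grading_twist q i v"], of "[]"]
      by (simp add: skew_tmult)
  qed
  then show ?thesis by (simp add: nichols_zero_skews)
qed

subsection \<open>Congruence modulo the Nichols ideal\<close>

text \<open>The scalar is part of the relation so that chains of commutations accumulate it.\<close>

definition nichols_cong :: "(nat \<Rightarrow> nat \<Rightarrow> 'a::field) \<Rightarrow> 'a \<Rightarrow> 'a tens \<Rightarrow> 'a tens \<Rightarrow> bool" where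
  "nichols_cong q c u v \<longleftrightarrow> nichols_zero q (\<lambda>w. u w - c * v w)"

lemma nichols_cong_refl: "nichols_cong q 1 u u"
  by (simp add: nichols_cong_def)

lemma nichols_cong_trans:
  assumes "nichols_cong q c u v" "nichols_cong q d v z"
  shows "nichols_cong q (c * d) u z"
proof -
  have "(\<lambda>w. (u w - c * v w) + c * (v w - d * z w)) = (\<lambda>w. u w - c * d * z w)"
    by (simp add: fun_eq_iff algebra_simps)
  then show ?thesis
    using nichols_zero_add[OF assms[unfolded nichols_cong_def], of c] by (simp add: nichols_cong_def)
qed

lemma nichols_cong_left: "nichols_cong q c u v \<Longrightarrow> nichols_cong q c (z \<cdot> u) (z \<cdot> v)"
  using nichols_zero_tmult[of q z "\<lambda>w. u w - c * v w"]
  by (simp add: nichols_cong_def tmult_diff_right)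

lemma nichols_cong_right: "nichols_cong q c u v \<Longrightarrow> nichols_cong q c (u \<cdot> z) (v \<cdot> z)"
  using nichols_zero_tmult[of q "\<lambda>w. u w - c * v w" z]
  by (simp add: nichols_cong_def tmult_diff_left)

lemma nichols_zero_cong:
  assumes "nichols_cong q c u v" "nichols_zero q v"
  shows "nichols_zero q u"
  using nichols_zero_add[OF assms(1)[unfolded nichols_cong_def] assms(2), of c] by simp

lemma chi_add_left [simp]: "chi q (A + B) C = chi q A C * chi q B C"
  and chi_add_right [simp]: "chi q A (B + C) = chi q A B * chi q A C"
  by (simp_all add: chi_def prod_mset.distrib)

lemma chi_empty [simp]: "chi q {#} B = 1" "chi q A {#} = 1"
  by (simp_all add: chi_def)

lemma chi_single: "chi q {#i#} {#j#} = q i j"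
  by (simp add: chi_def)

text \<open>The relation of two letters with p_ij p_ji = 1; for i = j and q_ii = -1 it reads x_i^2 = 0.\<close>
lemma letters_commute:
  assumes "q i j * q j i = 1"
  shows "nichols_cong q (q i j) (wordt [i] \<cdot> wordt [j]) (wordt [j] \<cdot> wordt [i])"
proof -
  let ?u = "\<lambda>w. (wordt [i] \<cdot> wordt [j]) w - q i j * (wordt [j] \<cdot> wordt [i]) w"
  have D: "skew q k (wordt [l]) = (\<lambda>w. if k = l then wordt [] w else 0)" for k l
  proof
    fix w show "skew q k (wordt [l]) w = (if k = l then wordt [] w else 0)"
      by (cases w) (auto simp: skew_sum wordt_def append_eq_Cons_conv)
  qed
  have T: "grading_twist q k (wordt [l]) = (\<lambda>w. q k l * wordt [l] w)" for k l
    by (auto simp: grading_twist_def wordt_def)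
  have S: "(\<lambda>w. if P then u w else 0) = (if P then u else (\<lambda>w. 0))" for P and u :: "'a tens"
    by simp
  have P: "skew q k (wordt [l] \<cdot> wordt [m])
     = (\<lambda>w. (if k = m then wordt [l] w else 0) + (if k = l then q k m * wordt [m] w else 0))" for k l m
    unfolding skew_tmult D T S by (auto simp: fun_eq_iff)
  \<comment> \<open>For i \<noteq> j, d_j leaves (1 - q_ij q_ji) x_i and d_i leaves q_ij x_j - q_ij
    x_j; for i = j the two combine to (1 - q_ii^2) x_i.\<close>
  have "skew q k ?u = (\<lambda>w. 0)" for k
  proof -
    have "skew q k ?u = (\<lambda>w. skew q k (wordt [i] \<cdot> wordt [j]) w - q i j * skew q k (wordt [j] \<cdot> wordt [i]) w)"
      using skew_add[of q k "wordt [i] \<cdot> wordt [j]" "- q i j" "wordt [j] \<cdot> wordt [i]"] by simp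
    also have "\<dots> = (\<lambda>w. 0)"
    proof
      have "q i j * (q j i * x) = x" for x
        using assms by (simp flip: mult.assoc)
      then show "skew q k (wordt [i] \<cdot> wordt [j]) w - q i j * skew q k (wordt [j] \<cdot> wordt [i]) w = 0" for w
        unfolding P using assms by (auto simp: distrib_left)
    qed
    finally show ?thesis .
  qed
  then have "nichols_zero q ?u"
    by (subst nichols_zero_rec) (simp add: tmult_Nil wordt_def)
  then show ?thesis by (simp add: nichols_cong_def)
qed

text \<open>Homogeneity as seen in B(V): by \<open>null\<close>, an element of the ideal has every
  degree. Generation from letters is built in so that commutation can be proved by
  induction.\<close>

inductive homogeneous :: "(nat \<Rightarrow> nat \<Rightarrow> 'a::field) \<Rightarrow> nat multiset \<Rightarrow> 'a tens \<Rightarrow> bool" for q where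
  one: "homogeneous q {#} (wordt [])"
| letter: "homogeneous q {#i#} (wordt [i])"
| null: "nichols_zero q u \<Longrightarrow> homogeneous q A u"
| lin: "homogeneous q A u \<Longrightarrow> homogeneous q A v \<Longrightarrow> homogeneous q A (\<lambda>w. u w + c * v w)"
| mult: "homogeneous q A u \<Longrightarrow> homogeneous q B v \<Longrightarrow> homogeneous q (A + B) (u \<cdot> v)"

lemma homogeneous_wordt: "homogeneous q (mset hs) (wordt hs)"
proof (induction hs)
  case (Cons i hs)
  have "wordt (i # hs) = wordt [i] \<cdot> wordt hs" by (simp add: wordt_mult)
  then show ?case
    using homogeneous.mult[OF homogeneous.letter Cons.IH, of i] unfolding \<open>wordt (i # hs) = _\<close> by simp
qed (simp add: homogeneous.one)

text \<open>A condition on degrees, so that it makes sense for all homogeneous elements and not only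
  for monomials. Since i = j is allowed, a letter with q_ii^2 \<noteq> 1 is adjacent to
  itself.\<close>

definition adj :: "(nat \<Rightarrow> nat \<Rightarrow> 'a::field) \<Rightarrow> nat multiset \<Rightarrow> nat multiset \<Rightarrow> bool" where
  "adj q A B \<longleftrightarrow> (\<exists>i\<in>#A. \<exists>j\<in>#B. q i j * q j i \<noteq> 1)"

lemma adj_commute: "adj q A B \<longleftrightarrow> adj q B A"
  unfolding adj_def by (metis mult.commute)

lemma adj_add_left [simp]: "adj q (A + B) C \<longleftrightarrow> adj q A C \<or> adj q B C"
  by (auto simp: adj_def)

lemma adj_add_right [simp]: "adj q C (A + B) \<longleftrightarrow> adj q C A \<or> adj q C B"
  by (auto simp: adj_def)

lemma not_adj_empty [simp]: "\<not> adj q {#} A" "\<not> adj q A {#}"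
  by (simp_all add: adj_def)

lemma chi_not_adj: "\<not> adj q A B \<Longrightarrow> chi q A B * chi q B A = 1"
proof (induction A)
  case (add i A)
  have "q i j * q j i = 1" if "j \<in># B" for j using add.prems that by (auto simp: adj_def)
  then have "chi q {#i#} B * chi q B {#i#} = 1"
    by (induction B) (auto simp: chi_def mult_ac)
  moreover have "chi q A B * chi q B A = 1" using add by (auto simp: adj_def)
  moreover have "add_mset i A = {#i#} + A" by simp
  ultimately show ?case by (simp only: chi_add_left chi_add_right) (simp add: mult_ac)
qed simp

text \<open>The scalar is multiplicative in both degrees, so a double induction reduces the claim to
  two letters, where it is \<open>letters_commute\<close>.\<close>

lemma homogeneous_commute:
  assumes "homogeneous q A u" "homogeneous q B v" "\<not> adj q A B"
  shows "nichols_cong q (chi q A B) (u \<cdot> v) (v \<cdot> u)"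
  using assms
proof (induction A u arbitrary: B v rule: homogeneous.induct)
  case one
  then show ?case by (simp add: nichols_cong_refl)
next
  case (letter i)
  then show ?case
  proof (induction B v rule: homogeneous.induct)
    case one
    then show ?case by (simp add: nichols_cong_refl)
  next
    case (letter j)
    then show ?case using letters_commute[of q i j] by (simp add: adj_def chi_single)
  next
    case (null u A)
    then show ?case
      unfolding nichols_cong_def by (intro nichols_zero_diff) (simp_all add: nichols_zero_tmult)
  next
    case (lin A u v c)
    then show ?case
      using nichols_zero_add[of q "\<lambda>w. (wordt [i] \<cdot> u) w - chi q {#i#} A * (u \<cdot> wordt [i]) w"
        "\<lambda>w. (wordt [i] \<cdot> v) w - chi q {#i#} A * (v \<cdot> wordt [i]) w" c]
      by (simp add: nichols_cong_def tmult_add_left tmult_add_right algebra_simps)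
  next
    case (mult A u B v)
    then have "nichols_cong q (chi q {#i#} A) (wordt [i] \<cdot> u) (u \<cdot> wordt [i])"
      "nichols_cong q (chi q {#i#} B) (wordt [i] \<cdot> v) (v \<cdot> wordt [i])" by auto
    from nichols_cong_trans[OF this(1)[THEN nichols_cong_right] this(2)[THEN nichols_cong_left, folded tmult_assoc]]
    show ?case by (simp add: tmult_assoc)
  qed
next
  case (null u A)
  then show ?case
    unfolding nichols_cong_def by (intro nichols_zero_diff) (simp_all add: nichols_zero_tmult)
next
  case (lin A u u' c B z)
  then have "nichols_cong q (chi q A B) (u \<cdot> z) (z \<cdot> u)" "nichols_cong q (chi q A B) (u' \<cdot> z) (z \<cdot> u')"
    by auto
  from nichols_zero_add[OF this[unfolded nichols_cong_def], of c] show ?case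
    by (simp add: nichols_cong_def tmult_add_left tmult_add_right algebra_simps)
next
  case (mult A u A' u')
  then have "nichols_cong q (chi q A B) (u \<cdot> v) (v \<cdot> u)"
    "nichols_cong q (chi q A' B) (u' \<cdot> v) (v \<cdot> u')" by auto
  from nichols_cong_trans[OF this(2)[THEN nichols_cong_left, folded tmult_assoc] this(1)[THEN nichols_cong_right]]
  show ?case by (simp add: tmult_assoc mult.commute)
qed

subsection \<open>Homogeneous components of the braided Lie algebra\<close>

inductive lie :: "nat \<Rightarrow> (nat \<Rightarrow> nat \<Rightarrow> 'a::field) \<Rightarrow> nat multiset \<Rightarrow> 'a tens \<Rightarrow> bool" for n q where
  letter: "i < n \<Longrightarrow> lie n q {#i#} (wordt [i])"
| null: "nichols_zero q u \<Longrightarrow> A \<noteq> {#} \<Longrightarrow> set_mset A \<subseteq> {..<n} \<Longrightarrow> lie n q A u"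
| lin: "lie n q A u \<Longrightarrow> lie n q A v \<Longrightarrow> lie n q A (\<lambda>w. u w + c * v w)"
| bracket: "lie n q A u \<Longrightarrow> lie n q B v \<Longrightarrow>
    lie n q (A + B) (\<lambda>w. (v \<cdot> u) w - chi q B A * (u \<cdot> v) w)"

lemma lie_degree: "lie n q A u \<Longrightarrow> A \<noteq> {#} \<and> set_mset A \<subseteq> {..<n}"
  by (induction rule: lie.induct) auto

lemma lie_homogeneous: "lie n q A u \<Longrightarrow> homogeneous q A u"
proof (induction rule: lie.induct)
  case (bracket A u B v)
  have "homogeneous q (A + B) (\<lambda>w. (v \<cdot> u) w + - chi q B A * (u \<cdot> v) w)"
    using homogeneous.mult[OF bracket.IH] homogeneous.mult[OF bracket.IH(2,1)]
    by (intro homogeneous.lin) (simp_all add: add.commute)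
  then show ?case by simp
qed (simp_all add: homogeneous.letter homogeneous.null homogeneous.lin)

lemma lie_scale:
  assumes "lie n q A u" shows "lie n q A (\<lambda>w. c * u w)"
  using lie.lin[OF lie.null[of q "\<lambda>w. 0" A n] assms, of c] lie_degree[OF assms] by simp

lemma lie_nichols_cong:
  assumes "nichols_cong q c u v" "lie n q A v"
  shows "lie n q A u"
  using lie.lin[OF lie.null[OF assms(1)[unfolded nichols_cong_def]] assms(2), of c] lie_degree[OF assms(2)]
  by simp

definition lie_cong :: "nat \<Rightarrow> (nat \<Rightarrow> nat \<Rightarrow> 'a::field) \<Rightarrow> nat multiset \<Rightarrow> 'a \<Rightarrow> 'a tens \<Rightarrow> 'a tens \<Rightarrow> bool" where
  "lie_cong n q A c u v \<longleftrightarrow> lie n q A (\<lambda>w. u w - c * v w)"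

lemma lie_cong_trans:
  assumes "lie_cong n q A c u v" "lie_cong n q A d v z"
  shows "lie_cong n q A (c * d) u z"
proof -
  have "(\<lambda>w. (u w - c * v w) + c * (v w - d * z w)) = (\<lambda>w. u w - c * d * z w)"
    by (simp add: fun_eq_iff algebra_simps)
  then show ?thesis
    using lie.lin[OF assms[unfolded lie_cong_def], of c] by (simp add: lie_cong_def)
qed

lemma lie_cong_nichols:
  "nichols_cong q c u v \<Longrightarrow> A \<noteq> {#} \<Longrightarrow> set_mset A \<subseteq> {..<n} \<Longrightarrow> lie_cong n q A c u v"
  unfolding nichols_cong_def lie_cong_def by (rule lie.null)

lemma lie_cong_bracket:
  "lie n q A u \<Longrightarrow> lie n q B v \<Longrightarrow> lie_cong n q (A + B) (chi q B A) (v \<cdot> u) (u \<cdot> v)"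
  unfolding lie_cong_def by (rule lie.bracket)

lemma lie_cong_lie:
  assumes "lie_cong n q A c u v" "lie n q A v"
  shows "lie n q A u"
  using lie.lin[OF assms(1)[unfolded lie_cong_def] assms(2), of c] by simp

text \<open>Subtracting the two congruences leaves (d - c) v in L(V), and d - c is invertible. Going
  around a product in two ways is turned into a membership here.\<close>

lemma lie_cong_unique:
  assumes "lie_cong n q A c u v" "lie_cong n q A d u v" "c \<noteq> d"
  shows "lie n q A v"
proof -
  have "(\<lambda>w. inverse (d - c) * ((u w - c * v w) + - 1 * (u w - d * v w))) = v"
    using assms(3) by (auto simp: fun_eq_iff field_simps)
  then show ?thesis
    using lie_scale[OF lie.lin[OF assms(1)[unfolded lie_cong_def] assms(2)[unfolded lie_cong_def], of "-1"],
        of "inverse (d - c)"] by simp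
qed

lemma lie_bracket_not_adj:
  assumes "lie n q A u" "lie n q B v" "\<not> adj q A B"
  shows "nichols_zero q (\<lambda>w. (v \<cdot> u) w - chi q B A * (u \<cdot> v) w)"
  using homogeneous_commute[OF lie_homogeneous[OF assms(2)] lie_homogeneous[OF assms(1)]] assms(3)
  by (simp add: adj_commute nichols_cong_def)

text \<open>If both factors of a bracket are nonzero, induction puts the letters of each on one side
  of X. Both sides occur, so they are opposite sides; then the factors are not adjacent and their
  bracket vanishes.\<close>

lemma lie_disconnected:
  assumes "lie n q A u" and "\<And>i j. i \<in># A \<Longrightarrow> j \<in># A \<Longrightarrow> i \<in> X \<Longrightarrow> j \<notin> X \<Longrightarrow> q i j * q j i = 1"
    and "\<exists>i\<in>#A. i \<in> X" "\<exists>j\<in>#A. j \<notin> X"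
  shows "nichols_zero q u"
  using assms
proof (induction rule: lie.induct)
  case (lin A u v c)
  from nichols_zero_add[OF lin.IH(1)[OF lin.prems] lin.IH(2)[OF lin.prems]] show ?case .
next
  case (bracket A u B v)
  note cross = bracket.prems(1)
  show ?case
  proof (cases "nichols_zero q u \<or> nichols_zero q v")
    case True
    then show ?thesis
      by (intro nichols_zero_diff nichols_zero_tmult) auto
  next
    case False
    have "nichols_zero q u" if "\<exists>i\<in>#A. i \<in> X" "\<exists>j\<in>#A. j \<notin> X"
      using bracket.IH(1)[OF _ that] cross by simp
    then have "set_mset A \<subseteq> X \<or> set_mset A \<inter> X = {}"
      using False by blast
    moreover have "nichols_zero q v" if "\<exists>i\<in>#B. i \<in> X" "\<exists>j\<in>#B. j \<notin> X"
      using bracket.IH(2)[OF _ that] cross by simp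
    then have "set_mset B \<subseteq> X \<or> set_mset B \<inter> X = {}"
      using False by blast
    ultimately have "set_mset A \<subseteq> X \<and> set_mset B \<inter> X = {} \<or> set_mset B \<subseteq> X \<and> set_mset A \<inter> X = {}"
      using bracket.prems(2,3) by auto
    moreover have "q i j * q j i = 1" if "i \<in># A" "j \<in># B" "(i \<in> X) \<noteq> (j \<in> X)" for i j
      using cross[of i j] cross[of j i] that by (cases "i \<in> X") (simp_all add: mult.commute)
    ultimately have "\<not> adj q A B"
      unfolding adj_def by blast
    then show ?thesis
      using lie_bracket_not_adj bracket.hyps by blast
  qed
qed simp_all


text \<open>Keeps A + {#x#} a sum of degrees, so that \<open>ac_simps\<close> and the additivity
  rules of \<open>chi\<close> and \<open>adj\<close> treat letters like any other factor.\<close>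

declare union_mset_add_mset_left [simp del] union_mset_add_mset_right [simp del]

section \<open>Products of adjacent elements of L(V)\<close>

locale diagonal_braiding =
  fixes n :: nat and q :: "nat \<Rightarrow> nat \<Rightarrow> 'a::field"
  assumes q_nonzero: "i < n \<Longrightarrow> j < n \<Longrightarrow> q i j \<noteq> 0"
begin

lemma chi_nonzero: "set_mset A \<subseteq> {..<n} \<Longrightarrow> set_mset B \<subseteq> {..<n} \<Longrightarrow> chi q A B \<noteq> 0"
  unfolding chi_def using q_nonzero by (fastforce simp: prod_mset_zero_iff)

lemma lie_mult_commute:
  assumes "lie n q A u" "lie n q B v" "lie n q (A + B) (u \<cdot> v)"
  shows "lie n q (A + B) (v \<cdot> u)"
  using lie_cong_lie[OF lie_cong_bracket[OF assms(1,2)] assms(3)] .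

text \<open>Moving w and then v cyclically, and moving v w at once, relate the products u v w and v w u by
  scalars whose quotient is chi(B, C) chi(C, B).\<close>
lemma lie_triple:
  assumes u: "lie n q A u" and v: "lie n q B v" and w: "lie n q C w"
    and uv: "lie n q (A + B) (u \<cdot> v)" and vw: "lie n q (B + C) (v \<cdot> w)" and wu: "lie n q (C + A) (w \<cdot> u)"
    and ne: "chi q B C * chi q C B \<noteq> 1"
  shows "lie n q (A + B + C) (u \<cdot> v \<cdot> w)" "lie n q (A + B + C) (v \<cdot> w \<cdot> u)"
    "lie n q (A + B + C) (w \<cdot> u \<cdot> v)"
proof -
  let ?D = "A + B + C"
  have 1: "lie_cong n q ?D (chi q A B * chi q A C) (u \<cdot> v \<cdot> w) (v \<cdot> w \<cdot> u)"
    using lie_cong_bracket[OF vw u] by (simp add: tmult_assoc ac_simps)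
  have "lie_cong n q ?D (chi q A C * chi q B C) (u \<cdot> v \<cdot> w) (w \<cdot> u \<cdot> v)"
    using lie_cong_bracket[OF w uv] by (simp add: tmult_assoc ac_simps)
  moreover have 2: "lie_cong n q ?D (chi q C B * chi q A B) (w \<cdot> u \<cdot> v) (v \<cdot> w \<cdot> u)"
    using lie_cong_bracket[OF v wu] by (simp add: tmult_assoc ac_simps)
  ultimately have "lie_cong n q ?D (chi q A C * chi q B C * (chi q C B * chi q A B)) (u \<cdot> v \<cdot> w) (v \<cdot> w \<cdot> u)"
    by (rule lie_cong_trans)
  moreover have "chi q A C * chi q B C * (chi q C B * chi q A B) \<noteq> chi q A B * chi q A C"
  proof
    assume "chi q A C * chi q B C * (chi q C B * chi q A B) = chi q A B * chi q A C"
    then have "chi q A B * chi q A C * (chi q B C * chi q C B) = chi q A B * chi q A C * 1"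
      by (simp add: mult_ac)
    then show False
      using ne chi_nonzero lie_degree[OF u] lie_degree[OF v] lie_degree[OF w]
      by (simp only: mult_cancel_left) auto
  qed
  ultimately show *: "lie n q ?D (v \<cdot> w \<cdot> u)"
    using lie_cong_unique[OF _ 1] by blast
  show "lie n q ?D (u \<cdot> v \<cdot> w)" "lie n q ?D (w \<cdot> u \<cdot> v)"
    by (rule lie_cong_lie[OF 1 *] lie_cong_lie[OF 2 *])+
qed

text \<open>The scalar is the one that makes the bracket of u and v vanish between y and z.\<close>
lemma lie_slide:
  assumes u: "lie n q C u" and v: "homogeneous q D v" and y: "homogeneous q Y y" and z: "homogeneous q Z z"
    and yvz: "lie n q (Y + D + Z) (y \<cdot> v \<cdot> z)" and nadj: "\<not> adj q C Y" "\<not> adj q C Z"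
  shows "lie_cong n q (C + Y + D + Z) (chi q C D) (y \<cdot> u \<cdot> v \<cdot> z) (y \<cdot> v \<cdot> u \<cdot> z)"
    and "lie_cong n q (C + Y + D + Z) (chi q D C) (y \<cdot> v \<cdot> u \<cdot> z) (y \<cdot> u \<cdot> v \<cdot> z)"
proof -
  let ?E = "C + Y + D + Z"
  have E: "?E \<noteq> {#}" "set_mset ?E \<subseteq> {..<n}"
    using lie_degree[OF u] lie_degree[OF yvz] by auto
  note hu = lie_homogeneous[OF u]
  \<comment> \<open>The factor u travels past y, then by a bracket with the element y v z of L(V) to
    the other end, then past z. The scalars contributed by y and z cancel in pairs.\<close>
  have left: "nichols_cong q (chi q Y C) (y \<cdot> u \<cdot> v \<cdot> z) (u \<cdot> y \<cdot> v \<cdot> z)"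
    "nichols_cong q (chi q C Y) (u \<cdot> y \<cdot> v \<cdot> z) (y \<cdot> u \<cdot> v \<cdot> z)"
    using nichols_cong_right[OF homogeneous_commute[OF y hu], of "v \<cdot> z"]
      nichols_cong_right[OF homogeneous_commute[OF hu y], of "v \<cdot> z"] nadj
    by (simp_all add: tmult_assoc adj_commute)
  have right: "nichols_cong q (chi q Z C) (y \<cdot> v \<cdot> z \<cdot> u) (y \<cdot> v \<cdot> u \<cdot> z)"
    "nichols_cong q (chi q C Z) (y \<cdot> v \<cdot> u \<cdot> z) (y \<cdot> v \<cdot> z \<cdot> u)"
    using nichols_cong_left[OF homogeneous_commute[OF z hu], of "y \<cdot> v"]
      nichols_cong_left[OF homogeneous_commute[OF hu z], of "y \<cdot> v"] nadj
    by (simp_all add: tmult_assoc adj_commute)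
  have swap: "lie_cong n q ?E (chi q C (Y + D + Z)) (u \<cdot> y \<cdot> v \<cdot> z) (y \<cdot> v \<cdot> z \<cdot> u)"
    "lie_cong n q ?E (chi q (Y + D + Z) C) (y \<cdot> v \<cdot> z \<cdot> u) (u \<cdot> y \<cdot> v \<cdot> z)"
    using lie_cong_bracket[OF yvz u] lie_cong_bracket[OF u yvz]
    by (simp_all only: tmult_assoc ac_simps)
  have inv: "chi q C Y * chi q Y C = 1" "chi q C Z * chi q Z C = 1"
    using nadj chi_not_adj by auto
  have "chi q Y C * chi q C (Y + D + Z) * chi q Z C = (chi q C Y * chi q Y C) * (chi q C Z * chi q Z C) * chi q C D"
    "chi q C Z * chi q (Y + D + Z) C * chi q C Y = (chi q C Y * chi q Y C) * (chi q C Z * chi q Z C) * chi q D C"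
    by (simp_all add: mult_ac)
  then have "chi q Y C * chi q C (Y + D + Z) * chi q Z C = chi q C D"
    "chi q C Z * chi q (Y + D + Z) C * chi q C Y = chi q D C"
    unfolding inv by simp_all
  then show "lie_cong n q ?E (chi q C D) (y \<cdot> u \<cdot> v \<cdot> z) (y \<cdot> v \<cdot> u \<cdot> z)"
    "lie_cong n q ?E (chi q D C) (y \<cdot> v \<cdot> u \<cdot> z) (y \<cdot> u \<cdot> v \<cdot> z)"
    using lie_cong_trans[OF lie_cong_trans[OF lie_cong_nichols[OF left(1) E] swap(1)] lie_cong_nichols[OF right(1) E]]
      lie_cong_trans[OF lie_cong_trans[OF lie_cong_nichols[OF right(2) E] swap(2)] lie_cong_nichols[OF left(2) E]]
    by (simp_all only:)
qed

section \<open>The induction on the total degree\<close>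

definition products_below :: "nat \<Rightarrow> bool" where
  "products_below N \<longleftrightarrow> (\<forall>A B u v. lie n q A u \<longrightarrow> lie n q B v \<longrightarrow> adj q A B \<longrightarrow>
     size A + size B < N \<longrightarrow> lie n q (A + B) (u \<cdot> v))"

text \<open>For three pairwise adjacent factors of total degree up to N,
  \<open>products_below\<close> guarantees only the two-factor pieces. Both orders are recorded
  because a bracket produces both, and u is arbitrary so that it can absorb a part of v when v is a
  bracket.\<close>

definition sandwich :: "nat \<Rightarrow> nat \<Rightarrow> nat multiset \<Rightarrow> 'a tens \<Rightarrow> bool" where
  "sandwich N x B v \<longleftrightarrow> (\<forall>A u. lie n q A u \<longrightarrow> size A + size B + 1 \<le> N \<longrightarrow>
     adj q A B \<longrightarrow> adj q A {#x#} \<longrightarrow> adj q B {#x#} \<longrightarrow>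
     lie n q (A + B + {#x#}) (v \<cdot> u \<cdot> wordt [x]) \<and> lie n q (A + B + {#x#}) (u \<cdot> v \<cdot> wordt [x]))"

lemma products_belowD:
  "products_below N \<Longrightarrow> lie n q A u \<Longrightarrow> lie n q B v \<Longrightarrow> adj q A B \<Longrightarrow> size A + size B < N \<Longrightarrow>
    lie n q (A + B) (u \<cdot> v)"
  by (simp add: products_below_def)

lemma sandwichD:
  assumes "sandwich N x B v" "lie n q A u" "size A + size B + 1 \<le> N"
    "adj q A B" "adj q A {#x#}" "adj q B {#x#}" "E = A + B + {#x#}"
  shows "lie n q E (v \<cdot> u \<cdot> wordt [x])" "lie n q E (u \<cdot> v \<cdot> wordt [x])"
  using assms by (auto simp: sandwich_def)

lemma size_lie_pos: "lie n q A u \<Longrightarrow> size A > 0"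
  using lie_degree by (metis nonempty_has_size)

text \<open>One of c, d is merged with a into a factor of smaller degree, and the sandwich property
  of the other one applies; non-adjacent neighbours are commuted into place. The hypotheses
  \<open>c'\<close> and \<open>d'\<close> say that neither c nor d is isolated from both a and
  x.\<close>

lemma sandwich_split:
  assumes N: "products_below N" and x: "x < n"
    and c: "lie n q C c" and d: "lie n q D d" and a: "lie n q A a"
    and sc: "sandwich N x C c" and sd: "sandwich N x D d"
    and sz: "size A + size C + size D + 1 \<le> N"
    and cd: "adj q C D" and ax: "adj q A {#x#}"
    and c': "adj q C {#x#} \<or> adj q A C" and d': "adj q D {#x#} \<or> adj q A D"
    and x': "adj q C {#x#} \<or> adj q D {#x#}" and a': "adj q A C \<or> adj q A D"
  shows "lie n q (A + C + D + {#x#}) (c \<cdot> d \<cdot> a \<cdot> wordt [x])"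
    and "lie n q (A + C + D + {#x#}) (a \<cdot> c \<cdot> d \<cdot> wordt [x])"
proof -
  let ?x = "wordt [x]" and ?E = "A + C + D + {#x#}"
  have lx: "lie n q {#x#} ?x" using x by (rule lie.letter)
  note pos = size_lie_pos[OF a] size_lie_pos[OF c] size_lie_pos[OF d]
  note prod = products_belowD[OF N]
  note comm = homogeneous_commute[OF lie_homogeneous lie_homogeneous]
  have dc: "adj q D C" using cd adj_commute by blast
  show "lie n q ?E (c \<cdot> d \<cdot> a \<cdot> ?x)"
  proof (cases "adj q C {#x#}")
    case cx: True
    show ?thesis
    proof (cases "adj q A D")
      case True
      have "lie n q (D + A) (d \<cdot> a)"
        using prod[OF d a] True sz pos by (simp add: adj_commute)
      from sandwichD(1)[OF sc this, of ?E] show ?thesis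
        using sz cx ax cd True dc by (simp add: tmult_assoc ac_simps)
    next
      case False
      then have ac: "adj q A C" and dx: "adj q D {#x#}" using a' d' by auto
      have "lie n q (C + A) (c \<cdot> a)"
        using prod[OF c a] ac sz pos by (simp add: adj_commute)
      from sandwichD(2)[OF sd this, of ?E] have "lie n q ?E (c \<cdot> a \<cdot> d \<cdot> ?x)"
        using sz cx ax cd dx by (simp add: tmult_assoc ac_simps)
      moreover have "nichols_cong q (chi q D A) (c \<cdot> d \<cdot> a \<cdot> ?x) (c \<cdot> a \<cdot> d \<cdot> ?x)"
        using nichols_cong_left[OF nichols_cong_right[OF comm[OF d a]], of c ?x] False
        by (simp add: tmult_assoc adj_commute)
      ultimately show ?thesis by (rule lie_nichols_cong[rotated])
    qed
  next
    case False
    then have ac: "adj q A C" and dx: "adj q D {#x#}" using c' x' by auto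
    have "lie n q (A + {#x#}) (a \<cdot> ?x)"
      using prod[OF a lx] ax sz pos by simp
    from prod[OF d this] have dax: "lie n q (D + (A + {#x#})) (d \<cdot> a \<cdot> ?x)"
      using dx sz pos by simp
    have "lie n q (A + C) (a \<cdot> c)" using prod[OF a c ac] sz pos by simp
    from sandwichD(1)[OF sd this, of ?E] have "lie n q ?E (d \<cdot> a \<cdot> c \<cdot> ?x)"
      using sz ax cd dx by (simp add: tmult_assoc ac_simps)
    moreover have "nichols_cong q (chi q {#x#} C) (d \<cdot> a \<cdot> ?x \<cdot> c) (d \<cdot> a \<cdot> c \<cdot> ?x)"
      using nichols_cong_left[OF comm[OF lx c], of "d \<cdot> a"] False
      by (simp add: tmult_assoc adj_commute)
    ultimately have "lie n q ?E (d \<cdot> a \<cdot> ?x \<cdot> c)"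
      by (rule lie_nichols_cong[rotated])
    \<comment> \<open>With c behind x the product reads (d a x) c, a rotation of the desired one,
      and d a x lies in L(V).\<close>
    then show ?thesis
      using lie_mult_commute[OF dax c] by (simp add: tmult_assoc ac_simps)
  qed
  show "lie n q ?E (a \<cdot> c \<cdot> d \<cdot> ?x)"
  proof (cases "adj q D {#x#}")
    case dx: True
    show ?thesis
    proof (cases "adj q A C")
      case True
      have "lie n q (A + C) (a \<cdot> c)" using prod[OF a c True] sz pos by simp
      from sandwichD(2)[OF sd this, of ?E] show ?thesis
        using sz ax cd dx by (simp add: tmult_assoc ac_simps)
    next
      case False
      then have ad: "adj q A D" and cx: "adj q C {#x#}" using a' c' by auto
      have "lie n q (A + D) (a \<cdot> d)" using prod[OF a d ad] sz pos by simp
      from sandwichD(1)[OF sc this, of ?E] have "lie n q ?E (c \<cdot> a \<cdot> d \<cdot> ?x)"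
        using sz ax dc cx by (simp add: tmult_assoc ac_simps)
      moreover have "nichols_cong q (chi q A C) (a \<cdot> c \<cdot> d \<cdot> ?x) (c \<cdot> a \<cdot> d \<cdot> ?x)"
        using nichols_cong_right[OF comm[OF a c False], of "d \<cdot> ?x"] by (simp add: tmult_assoc)
      ultimately show ?thesis by (rule lie_nichols_cong[rotated])
    qed
  next
    case False
    then have ad: "adj q A D" and cx: "adj q C {#x#}" using d' x' by auto
    have "lie n q (C + {#x#}) (c \<cdot> ?x)"
      using prod[OF c lx cx] sz pos by simp
    from prod[OF a this] have acx: "lie n q (A + (C + {#x#})) (a \<cdot> c \<cdot> ?x)"
      using ax sz pos by simp
    have "lie n q (D + A) (d \<cdot> a)"
      using prod[OF d a] ad sz pos by (simp add: adj_commute)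
    from sandwichD(2)[OF sc this, of ?E] have "lie n q ?E (d \<cdot> a \<cdot> c \<cdot> ?x)"
      using sz ax dc cx by (simp add: tmult_assoc ac_simps)
    then have "lie n q ?E (a \<cdot> c \<cdot> ?x \<cdot> d)"
      using lie_mult_commute[OF d acx] by (simp add: tmult_assoc ac_simps)
    moreover have "nichols_cong q (chi q D {#x#}) (a \<cdot> c \<cdot> d \<cdot> ?x) (a \<cdot> c \<cdot> ?x \<cdot> d)"
      using nichols_cong_left[OF comm[OF d lx False], of "a \<cdot> c"] by (simp add: tmult_assoc)
    ultimately show ?thesis by (rule lie_nichols_cong[rotated])
  qed
qed

text \<open>Induction on v. The base case is the point where adjacency yields the inequality needed
  in \<open>lie_triple\<close>, as both y and x are letters there.\<close>

lemma sandwich_lie: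
  assumes "products_below N" "x < n" "lie n q B v"
  shows "sandwich N x B v"
  using assms(3)
proof (induction rule: lie.induct)
  case (letter y)
  show ?case
    unfolding sandwich_def
  proof (intro allI impI)
    fix A u
    assume u: "lie n q A u" and sz: "size A + size {#y#} + 1 \<le> N"
      and ay: "adj q A {#y#}" and ax: "adj q A {#x#}" and yx: "adj q {#y#} {#x#}"
    have y: "lie n q {#y#} (wordt [y])" and x: "lie n q {#x#} (wordt [x])"
      using letter assms(2) by (auto intro: lie.letter)
    note prod = products_belowD[OF assms(1)]
    have sz': "size A + 1 < N" "1 + 1 < N" using sz size_lie_pos[OF u] by auto
    have ne: "chi q {#y#} {#x#} * chi q {#x#} {#y#} \<noteq> 1"
      using yx by (simp add: adj_def chi_single)
    have "lie n q (A + {#y#}) (u \<cdot> wordt [y])" "lie n q ({#y#} + {#x#}) (wordt [y] \<cdot> wordt [x])"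
      "lie n q ({#x#} + A) (wordt [x] \<cdot> u)"
      using prod[OF u y ay] prod[OF y x yx] prod[OF x u] ax sz' by (simp_all add: adj_commute)
    \<comment> \<open>The orders u y x and y u x belong to different cyclic classes, so the triples
      (u, y, x) and (u, x, y) are treated separately.\<close>
    note 1 = lie_triple(1)[OF u y x this ne]
    have "lie n q (A + {#x#}) (u \<cdot> wordt [x])" "lie n q ({#x#} + {#y#}) (wordt [x] \<cdot> wordt [y])"
      "lie n q ({#y#} + A) (wordt [y] \<cdot> u)"
      using prod[OF u x ax] prod[OF x y] prod[OF y u] yx ay sz' by (simp_all add: adj_commute)
    note 2 = lie_triple(3)[OF u x y this]
    show "lie n q (A + {#y#} + {#x#}) (wordt [y] \<cdot> u \<cdot> wordt [x]) \<and>
      lie n q (A + {#y#} + {#x#}) (u \<cdot> wordt [y] \<cdot> wordt [x])"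
      using 1 2 ne by (simp add: ac_simps)
  qed
next
  case (null v B)
  then show ?case
    unfolding sandwich_def using assms(2)
    by (auto intro!: lie.null nichols_zero_tmult dest!: lie_degree)
next
  case (lin B v v' c)
  then show ?case
    unfolding sandwich_def tmult_add_left tmult_add_right by (simp add: lie.lin)
next
  case (bracket C c D d)
  show ?case
    unfolding sandwich_def
  proof (intro allI impI)
    fix A a
    assume a: "lie n q A a" and sz: "size A + size (C + D) + 1 \<le> N"
      and ab: "adj q A (C + D)" and ax: "adj q A {#x#}" and bx: "adj q (C + D) {#x#}"
    let ?x = "wordt [x]" and ?E = "A + C + D + {#x#}"
      and ?v = "\<lambda>w. (d \<cdot> c) w - chi q D C * (c \<cdot> d) w"
    have lx: "lie n q {#x#} ?x" using assms(2) by (rule lie.letter)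
    note prod = products_belowD[OF assms(1)]
    note pos = size_lie_pos[OF a] size_lie_pos[OF bracket.hyps(1)] size_lie_pos[OF bracket.hyps(2)]
    have E: "?E \<noteq> {#}" "set_mset ?E \<subseteq> {..<n}"
      using lie_degree[OF a] lie_degree[OF bracket.hyps(1)] lie_degree[OF bracket.hyps(2)] assms(2) by auto
    have axl: "lie n q (A + {#x#}) (a \<cdot> ?x)" using prod[OF a lx ax] sz pos by simp
    have expand: "?v \<cdot> a \<cdot> ?x = (\<lambda>w. (d \<cdot> c \<cdot> a \<cdot> ?x) w - chi q D C * (c \<cdot> d \<cdot> a \<cdot> ?x) w)"
      "a \<cdot> ?v \<cdot> ?x = (\<lambda>w. (a \<cdot> d \<cdot> c \<cdot> ?x) w - chi q D C * (a \<cdot> c \<cdot> d \<cdot> ?x) w)"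
      by (simp_all add: tmult_diff_left tmult_diff_right tmult_assoc)
    have "lie n q ?E (?v \<cdot> a \<cdot> ?x) \<and> lie n q ?E (a \<cdot> ?v \<cdot> ?x)"
    proof (cases "adj q C D")
      case False
      then have "nichols_zero q ?v" using lie_bracket_not_adj bracket.hyps by blast
      then show ?thesis using E by (auto intro!: lie.null nichols_zero_tmult)
    next
      case cd: True
      then have dc: "adj q D C" using adj_commute by blast
      \<comment> \<open>If one half of the bracket is adjacent to neither a nor x,
        \<open>lie_slide\<close> gives a congruence with exactly the scalar chi(D, C) of the
        bracket; otherwise \<open>sandwich_split\<close> handles both products.\<close>
      consider "\<not> adj q C A" "\<not> adj q C {#x#}" | "\<not> adj q D A" "\<not> adj q D {#x#}"
        | "adj q C {#x#} \<or> adj q A C" "adj q D {#x#} \<or> adj q A D"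
        using adj_commute by blast
      then show ?thesis
      proof cases
        case 1
        have dx: "adj q D {#x#}" and ad: "adj q A D" using 1 ab bx adj_commute by auto
        \<comment> \<open>The empty word stands for the left factor y of
          \<open>lie_slide\<close>.\<close>
        have dax: "lie n q ({#} + D + (A + {#x#})) (wordt [] \<cdot> d \<cdot> a \<cdot> ?x)"
          using prod[OF bracket.hyps(2) axl] dx sz pos by simp
        have "lie n q (D + {#x#}) (d \<cdot> ?x)" using prod[OF bracket.hyps(2) lx dx] sz pos by simp
        then have adx: "lie n q (A + D + {#x#}) (a \<cdot> d \<cdot> ?x)"
          using prod[OF a, of "D + {#x#}"] ad sz pos by (simp add: add.assoc)
        note h = lie_homogeneous[OF bracket.hyps(2)] lie_homogeneous[OF a] lie_homogeneous[OF lx]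
        have "lie_cong n q ?E (chi q D C) (d \<cdot> c \<cdot> a \<cdot> ?x) (c \<cdot> d \<cdot> a \<cdot> ?x)"
          using lie_slide(2)[OF bracket.hyps(1) h(1) homogeneous.one lie_homogeneous[OF axl] dax] 1
          by (simp add: ac_simps)
        moreover have "lie_cong n q ?E (chi q D C) (a \<cdot> d \<cdot> c \<cdot> ?x) (a \<cdot> c \<cdot> d \<cdot> ?x)"
          using lie_slide(2)[OF bracket.hyps(1) h adx] 1 by (simp add: ac_simps)
        ultimately show ?thesis unfolding expand lie_cong_def ..
      next
        case 2
        have cx: "adj q C {#x#}" and ac: "adj q A C" using 2 ab bx adj_commute by auto
        have cax: "lie n q ({#} + C + (A + {#x#})) (wordt [] \<cdot> c \<cdot> a \<cdot> ?x)"
          using prod[OF bracket.hyps(1) axl] cx sz pos by simp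
        have "lie n q (C + {#x#}) (c \<cdot> ?x)" using prod[OF bracket.hyps(1) lx cx] sz pos by simp
        then have acx: "lie n q (A + C + {#x#}) (a \<cdot> c \<cdot> ?x)"
          using prod[OF a, of "C + {#x#}"] ac sz pos by (simp add: add.assoc)
        note h = lie_homogeneous[OF bracket.hyps(1)] lie_homogeneous[OF a] lie_homogeneous[OF lx]
        have "lie_cong n q ?E (chi q D C) (d \<cdot> c \<cdot> a \<cdot> ?x) (c \<cdot> d \<cdot> a \<cdot> ?x)"
          using lie_slide(1)[OF bracket.hyps(2) h(1) homogeneous.one lie_homogeneous[OF axl] cax] 2
          by (simp add: ac_simps)
        moreover have "lie_cong n q ?E (chi q D C) (a \<cdot> d \<cdot> c \<cdot> ?x) (a \<cdot> c \<cdot> d \<cdot> ?x)"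
          using lie_slide(1)[OF bracket.hyps(2) h acx] 2 by (simp add: ac_simps)
        ultimately show ?thesis unfolding expand lie_cong_def ..
      next
        case 3
        have "lie n q ?E (c \<cdot> d \<cdot> a \<cdot> ?x)" "lie n q ?E (a \<cdot> c \<cdot> d \<cdot> ?x)"
          by (rule sandwich_split[OF assms(1,2) bracket.hyps a bracket.IH]; use sz cd ax 3 bx ab in force)+
        moreover have "lie n q (A + D + C + {#x#}) (d \<cdot> c \<cdot> a \<cdot> ?x)" "lie n q (A + D + C + {#x#}) (a \<cdot> d \<cdot> c \<cdot> ?x)"
          by (rule sandwich_split[OF assms(1,2) bracket.hyps(2,1) a bracket.IH(2,1)]; use sz dc ax 3 bx ab in force)+
        moreover have "A + D + C + {#x#} = ?E" by simp
        ultimately show ?thesis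
          unfolding expand using lie.lin[of n q ?E _ _ "- chi q D C"] by simp
      qed
    qed
    then show "lie n q (A + (C + D) + {#x#}) (?v \<cdot> a \<cdot> ?x) \<and> lie n q (A + (C + D) + {#x#}) (a \<cdot> ?v \<cdot> ?x)"
      by (simp add: ac_simps)
  qed
qed

text \<open>For a bracket u = [c,d] with c, d adjacent, the sandwich property applies when x is
  adjacent to both c and d; if x is adjacent to only one of them, the other slides through the
  product.\<close>

lemma lie_mult_letter:
  assumes N: "products_below N" and x: "x < n" and u: "lie n q A u"
    and sz: "size A + 1 \<le> N" and ax: "adj q A {#x#}"
  shows "lie n q (A + {#x#}) (u \<cdot> wordt [x])"
  using u sz ax
proof (induction rule: lie.induct)
  case (letter y)
  have y: "lie n q {#y#} (wordt [y])" and x: "lie n q {#x#} (wordt [x])"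
    using letter.hyps assms(2) by (auto intro: lie.letter)
  have 1: "lie_cong n q ({#y#} + {#x#}) (q y x) (wordt [y] \<cdot> wordt [x]) (wordt [x] \<cdot> wordt [y])"
    "lie_cong n q ({#y#} + {#x#}) (q x y) (wordt [x] \<cdot> wordt [y]) (wordt [y] \<cdot> wordt [x])"
    using lie_cong_bracket[OF x y] lie_cong_bracket[OF y x] by (simp_all add: chi_single add.commute add_mset_commute)
  \<comment> \<open>Passing from y x to x y and back multiplies by q_yx q_xy \<noteq> 1, whereas y x
    is also congruent to itself with scalar 1.\<close>
  have "lie_cong n q ({#y#} + {#x#}) 1 (wordt [y] \<cdot> wordt [x]) (wordt [y] \<cdot> wordt [x])"
    using letter.hyps assms(2) by (intro lie_cong_nichols nichols_cong_refl) auto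
  from lie_cong_unique[OF lie_cong_trans[OF 1] this] show ?case
    using letter.prems by (auto simp: adj_def)
next
  case (null u A)
  then show ?case using x by (auto intro!: lie.null nichols_zero_tmult)
next
  case (lin A u v c)
  then show ?case by (simp add: tmult_add_left lie.lin)
next
  case (bracket C c D d)
  let ?x = "wordt [x]" and ?E = "C + D + {#x#}"
  have lx: "lie n q {#x#} ?x" using x by (rule lie.letter)
  note pos = size_lie_pos[OF bracket.hyps(1)] size_lie_pos[OF bracket.hyps(2)]
  note prod = products_belowD[OF N]
  have expand: "(\<lambda>w. (d \<cdot> c) w - chi q D C * (c \<cdot> d) w) \<cdot> ?x
      = (\<lambda>w. (d \<cdot> c \<cdot> ?x) w - chi q D C * (c \<cdot> d \<cdot> ?x) w)"
    by (simp add: tmult_diff_left tmult_assoc)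
  show ?case
  proof (cases "adj q C D")
    case False
    then have "nichols_zero q (\<lambda>w. (d \<cdot> c) w - chi q D C * (c \<cdot> d) w)"
      using lie_bracket_not_adj bracket.hyps by blast
    then show ?thesis
      using lie_degree[OF bracket.hyps(1)] lie_degree[OF bracket.hyps(2)] x
      by (auto intro!: lie.null nichols_zero_tmult)
  next
    case cd: True
    consider "\<not> adj q C {#x#}" "adj q D {#x#}" | "\<not> adj q D {#x#}" "adj q C {#x#}"
      | "adj q C {#x#}" "adj q D {#x#}"
      using bracket.prems by auto
    then show ?thesis
    proof cases
      case 1
      have "lie n q ({#} + D + {#x#}) (wordt [] \<cdot> d \<cdot> ?x)"
        using prod[OF bracket.hyps(2) lx 1(2)] bracket.prems pos by simp
      from lie_slide(2)[OF bracket.hyps(1) lie_homogeneous[OF bracket.hyps(2)] homogeneous.one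
          lie_homogeneous[OF lx] this] 1
      show ?thesis unfolding expand lie_cong_def by simp
    next
      case 2
      have "lie n q ({#} + C + {#x#}) (wordt [] \<cdot> c \<cdot> ?x)"
        using prod[OF bracket.hyps(1) lx 2(2)] bracket.prems pos by simp
      from lie_slide(1)[OF bracket.hyps(2) lie_homogeneous[OF bracket.hyps(1)] homogeneous.one
          lie_homogeneous[OF lx] this] 2
      show ?thesis unfolding expand lie_cong_def by (simp add: ac_simps)
    next
      case 3
      have "lie n q ?E (d \<cdot> c \<cdot> ?x)" "lie n q ?E (c \<cdot> d \<cdot> ?x)"
        using sandwichD[OF sandwich_lie[OF N x bracket.hyps(2)] bracket.hyps(1), of ?E] cd 3 bracket.prems
        by simp_all
      then show ?thesis
        unfolding expand using lie.lin[of n q ?E _ _ "- chi q D C"] by simp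
    qed
  qed
qed

text \<open>Induction on the right factor with the left one arbitrary: in u c d the factor u absorbs
  whichever of c, d it is adjacent to, and the result is adjacent to the other because c and d are
  adjacent.\<close>

lemma lie_mult_step:
  assumes N: "products_below N" and v: "lie n q B v" and u: "lie n q A u"
    and ab: "adj q A B" and sz: "size A + size B \<le> N"
  shows "lie n q (A + B) (u \<cdot> v)"
  using v u ab sz
proof (induction arbitrary: A u rule: lie.induct)
  case (letter x)
  then show ?case using lie_mult_letter[OF N] by simp
next
  case (null v B)
  then show ?case by (auto intro!: lie.null nichols_zero_tmult dest!: lie_degree)
next
  case (lin B v v' c)
  then show ?case by (simp add: tmult_add_right lie.lin)
next
  case (bracket C c D d)
  let ?E = "A + (C + D)"
  have E: "?E \<noteq> {#}" "set_mset ?E \<subseteq> {..<n}"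
    using lie_degree[OF bracket.prems(1)] lie_degree[OF bracket.hyps(1)] lie_degree[OF bracket.hyps(2)] by auto
  \<comment> \<open>Stated for new C, c, D, d so that it serves both orders of the bracket; the
    assumption \<open>E\<close> ties their degree to the fixed \<open>?E\<close>.\<close>
  have half: "lie n q ?E (u \<cdot> c \<cdot> d)"
    if c: "lie n q C c" and d: "lie n q D d" and cd: "adj q C D" and "adj q A C \<or> adj q A D"
      and sz: "size A + size C + size D \<le> N" and E: "?E = A + (C + D)"
      and IHc: "\<And>A u. lie n q A u \<Longrightarrow> adj q A C \<Longrightarrow> size A + size C \<le> N \<Longrightarrow> lie n q (A + C) (u \<cdot> c)"
      and IHd: "\<And>A u. lie n q A u \<Longrightarrow> adj q A D \<Longrightarrow> size A + size D \<le> N \<Longrightarrow> lie n q (A + D) (u \<cdot> d)"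
    for C c D d
  proof (cases "adj q A C")
    case True
    have "lie n q (A + C) (u \<cdot> c)"
      using products_belowD[OF N bracket.prems(1) c True] sz size_lie_pos[OF d] by simp
    from IHd[OF this] show ?thesis
      unfolding E using cd sz by (simp add: tmult_assoc add.assoc)
  next
    case False
    then have "lie n q (A + D) (u \<cdot> d)"
      using products_belowD[OF N bracket.prems(1) d] sz size_lie_pos[OF c] that(4) by simp
    from lie_mult_commute[OF this c] IHc[OF this] have "lie n q (A + D + C) (c \<cdot> u \<cdot> d)"
      using cd sz by (simp add: adj_commute)
    moreover have "nichols_cong q (chi q A C) (u \<cdot> c \<cdot> d) (c \<cdot> u \<cdot> d)"
      using nichols_cong_right[OF homogeneous_commute[OF lie_homogeneous[OF bracket.prems(1)]
            lie_homogeneous[OF c] False], of d]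
      by (simp add: tmult_assoc)
    ultimately show ?thesis
      unfolding E using lie_nichols_cong by (simp add: ac_simps)
  qed
  have expand: "u \<cdot> (\<lambda>w. (d \<cdot> c) w - chi q D C * (c \<cdot> d) w)
      = (\<lambda>w. (u \<cdot> d \<cdot> c) w - chi q D C * (u \<cdot> c \<cdot> d) w)"
    by (simp add: tmult_diff_right)
  show ?case
  proof (cases "adj q C D")
    case False
    then have "nichols_zero q (\<lambda>w. (d \<cdot> c) w - chi q D C * (c \<cdot> d) w)"
      using lie_bracket_not_adj bracket.hyps by blast
    then show ?thesis using E by (auto intro!: lie.null nichols_zero_tmult)
  next
    case cd: True
    have "lie n q ?E (u \<cdot> c \<cdot> d)"
      by (rule half[OF bracket.hyps cd _ _ _ bracket.IH]) (use bracket.prems in auto)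
    moreover have "lie n q ?E (u \<cdot> d \<cdot> c)"
      by (rule half[OF bracket.hyps(2,1) _ _ _ _ bracket.IH(2,1)])
        (use bracket.prems cd adj_commute in \<open>auto simp: ac_simps\<close>)
    ultimately show ?thesis
      unfolding expand using lie.lin[of n q ?E _ _ "- chi q D C"] by simp
  qed
qed

lemma products_below: "products_below N"
proof (induction N)
  case (Suc N)
  then show ?case
    using lie_mult_step[OF Suc] unfolding products_below_def[of "Suc N"] by simp
qed (simp add: products_below_def)

theorem lie_mult:
  assumes "lie n q A u" "lie n q B v" "adj q A B"
  shows "lie n q (A + B) (u \<cdot> v)"
  using products_belowD[OF products_below assms] by blast

end


declare union_mset_add_mset_left [simp] union_mset_add_mset_right [simp]

subsection \<open>Iterated brackets of letters\<close>

lemma lie_bval: "set_mset (leaves t) \<subseteq> {..<n} \<Longrightarrow> lie n q (leaves t) (bval q t)"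
proof (induction t)
  case (Leaf i)
  then show ?case by (simp add: letter_eq_wordt lie.letter)
next
  case (Node a b)
  then show ?case by (simp add: lie.bracket)
qed

lemma bval_support: "bval q t w \<noteq> 0 \<Longrightarrow> mset w = leaves t"
proof (induction t arbitrary: w)
  case (Leaf i)
  then show ?case by (simp add: letter_def split: if_splits)
next
  case (Node a b)
  have split: "\<exists>k. u (take k w) \<noteq> 0 \<and> v (drop k w) \<noteq> 0" if "(u \<cdot> v) w \<noteq> 0" for u v :: "'a tens"
    using that unfolding tmult_def by (metis (no_types, lifting) mult_zero_left mult_zero_right sum.neutral)
  have "(bval q b \<cdot> bval q a) w \<noteq> 0 \<or> (bval q a \<cdot> bval q b) w \<noteq> 0"
    using Node.prems by auto
  then obtain k where "mset (take k w) = leaves b \<and> mset (drop k w) = leaves a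
      \<or> mset (take k w) = leaves a \<and> mset (drop k w) = leaves b"
    using split[of "bval q b" "bval q a"] split[of "bval q a" "bval q b"] Node.IH by blast
  then show ?case
    by (metis add.commute append_take_drop_id leaves.simps(2) mset_append)
qed

lemma lie_span:
  assumes "lie n q A u"
  shows "\<exists>T c. finite T \<and> (\<forall>t\<in>T. leaves t = A) \<and> nichols_zero q (\<lambda>w. u w - (\<Sum>t\<in>T. c t * bval q t w))"
  using assms
proof (induction rule: lie.induct)
  case (letter i)
  show ?case
    by (intro exI[of _ "{Leaf i}"] exI[of _ "\<lambda>_. 1"]) (simp add: letter_eq_wordt)
next
  case (null u A)
  then show ?case by (intro exI[of _ "{}"]) simp
next
  case (lin A u v k)
  then obtain T S c d where T: "finite T" "\<forall>t\<in>T. leaves t = A"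
      "nichols_zero q (\<lambda>w. u w - (\<Sum>t\<in>T. c t * bval q t w))"
    and S: "finite S" "\<forall>t\<in>S. leaves t = A"
      "nichols_zero q (\<lambda>w. v w - (\<Sum>t\<in>S. d t * bval q t w))"
    by blast
  let ?e = "\<lambda>t. (if t \<in> T then c t else 0) + k * (if t \<in> S then d t else 0)"
  have "(\<Sum>t\<in>T \<union> S. ?e t * f t) = (\<Sum>t\<in>T. c t * f t) + k * (\<Sum>t\<in>S. d t * f t)" for f
  proof -
    have "(\<Sum>t\<in>T \<union> S. (if t \<in> T then c t else 0) * f t) = (\<Sum>t\<in>T. c t * f t)"
      "(\<Sum>t\<in>T \<union> S. (if t \<in> S then d t else 0) * f t) = (\<Sum>t\<in>S. d t * f t)"
      using T(1) S(1) by (auto intro!: sum.mono_neutral_cong_right)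
    then show ?thesis
      by (simp add: distrib_right sum.distrib mult.assoc flip: sum_distrib_left)
  qed
  then have "nichols_zero q (\<lambda>w. (u w + k * v w) - (\<Sum>t\<in>T \<union> S. ?e t * bval q t w))"
    using nichols_zero_add[OF T(3) S(3), of k] by (simp add: algebra_simps)
  then show ?case
    using T(1,2) S(1,2) by (intro exI[of _ "T \<union> S"] exI[of _ ?e]) auto
next
  case (bracket A u B v)
  then obtain T S c d where T: "finite T" "\<forall>t\<in>T. leaves t = A"
      "nichols_zero q (\<lambda>w. u w - (\<Sum>t\<in>T. c t * bval q t w))"
    and S: "finite S" "\<forall>t\<in>S. leaves t = B"
      "nichols_zero q (\<lambda>w. v w - (\<Sum>t\<in>S. d t * bval q t w))"
    by blast
  let ?u = "\<lambda>w. \<Sum>t\<in>T. c t * bval q t w" and ?v = "\<lambda>w. \<Sum>t\<in>S. d t * bval q t w"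
  \<comment> \<open>Bilinear expansion: each tree of \<open>?R\<close> determines its t and s, and
    the coefficient 0 at leaves is only a default.\<close>
  let ?R = "(\<lambda>(t, s). Node t s) ` (T \<times> S)"
    and ?e = "\<lambda>r. case r of Node t s \<Rightarrow> c t * d s | Leaf i \<Rightarrow> 0"
  have u: "nichols_cong q 1 u ?u" and v: "nichols_cong q 1 v ?v"
    using T(3) S(3) by (simp_all add: nichols_cong_def)
  have vu: "nichols_cong q 1 (v \<cdot> u) (?v \<cdot> ?u)" and uv: "nichols_cong q 1 (u \<cdot> v) (?u \<cdot> ?v)"
    using nichols_cong_trans[OF nichols_cong_right[OF v] nichols_cong_left[OF u]]
      nichols_cong_trans[OF nichols_cong_right[OF u] nichols_cong_left[OF v]] by simp_all
  have sum: "(\<Sum>r\<in>?R. ?e r * bval q r w) = (?v \<cdot> ?u) w - chi q B A * (?u \<cdot> ?v) w" for w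
  proof -
    have "(\<Sum>r\<in>?R. ?e r * bval q r w)
        = (\<Sum>(t, s)\<in>T \<times> S. c t * d s * bval q (Node t s) w)"
      by (subst sum.reindex) (auto simp: inj_on_def case_prod_unfold)
    also have "\<dots> = (\<Sum>t\<in>T. \<Sum>s\<in>S. c t * d s * bval q (Node t s) w)"
      by (simp add: sum.cartesian_product)
    also have "\<dots> = (\<Sum>t\<in>T. \<Sum>s\<in>S. c t * d s * ((bval q s \<cdot> bval q t) w
        - chi q B A * (bval q t \<cdot> bval q s) w))"
      using T(2) S(2) by (intro sum.cong refl) simp
    also have "\<dots> = (\<Sum>t\<in>T. \<Sum>s\<in>S. c t * (d s * (bval q s \<cdot> bval q t) w))
        - chi q B A * (\<Sum>t\<in>T. \<Sum>s\<in>S. c t * (d s * (bval q t \<cdot> bval q s) w))"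
      by (simp add: sum_distrib_left right_diff_distrib sum_subtractf mult_ac)
    also have "(\<Sum>t\<in>T. \<Sum>s\<in>S. c t * (d s * (bval q s \<cdot> bval q t) w)) = (?v \<cdot> ?u) w"
      by (subst sum.swap) (simp add: tmult_sum_left tmult_sum_right sum_distrib_left mult.left_commute)
    also have "(\<Sum>t\<in>T. \<Sum>s\<in>S. c t * (d s * (bval q t \<cdot> bval q s) w)) = (?u \<cdot> ?v) w"
      by (simp add: tmult_sum_left tmult_sum_right sum_distrib_left)
    finally show ?thesis .
  qed
  have "(\<lambda>w. (v \<cdot> u) w - 1 * (?v \<cdot> ?u) w - chi q B A * ((u \<cdot> v) w - 1 * (?u \<cdot> ?v) w))
      = (\<lambda>w. (v \<cdot> u) w - chi q B A * (u \<cdot> v) w - (\<Sum>r\<in>?R. ?e r * bval q r w))"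
    unfolding sum by (simp add: fun_eq_iff algebra_simps)
  with nichols_zero_diff[OF vu[unfolded nichols_cong_def] uv[unfolded nichols_cong_def], of "chi q B A"]
  have "nichols_zero q (\<lambda>w. (v \<cdot> u) w - chi q B A * (u \<cdot> v) w - (\<Sum>r\<in>?R. ?e r * bval q r w))"
    by (simp only:)
  then show ?case
    using T(1,2) S(1,2) by (intro exI[of _ ?R] exI[of _ ?e]) auto
qed

lemma lie_in_L: "lie n q A u \<Longrightarrow> in_L n q u"
  unfolding in_L_def using lie_span[of n q A u] lie_degree[of n q A u] by metis

text \<open>Only the brackets of the degree of the monomial contribute to its component.\<close>
lemma in_L_wordt_lie:
  assumes "in_L n q (wordt hs)" "hs \<noteq> []" "set hs \<subseteq> {..<n}"
  shows "lie n q (mset hs) (wordt hs)"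
proof -
  obtain T c where T: "finite T" "\<And>t. t \<in> T \<Longrightarrow> set_mset (leaves t) \<subseteq> {..<n}"
    and z: "nichols_zero q (\<lambda>w. wordt hs w - (\<Sum>t\<in>T. c t * bval q t w))"
    using assms(1) unfolding in_L_def by auto
  define T' where "T' = {t \<in> T. leaves t = mset hs}"
  have zero: "nichols_zero q (\<lambda>w. wordt hs w - (\<Sum>t\<in>T'. c t * bval q t w))"
    unfolding nichols_zero_def
  proof
    fix s
    show "(\<Sum>w | mset w = mset s. (wordt hs w - (\<Sum>t\<in>T'. c t * bval q t w)) * dpair q s w) = 0"
    \<comment> \<open>The test by s sees words of one degree only. In the degree of
      \<open>hs\<close> the trees left out of \<open>T'\<close> vanish; in any other degree all that
      is kept vanishes.\<close>
    proof (cases "mset s = mset hs")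
      case True
      have "(\<Sum>t\<in>T'. c t * bval q t w) = (\<Sum>t\<in>T. c t * bval q t w)" if "mset w = mset s" for w
        unfolding T'_def using T(1) bval_support[of q _ w] that True
        by (intro sum.mono_neutral_left) auto
      then have "(\<Sum>w | mset w = mset s. (wordt hs w - (\<Sum>t\<in>T'. c t * bval q t w)) * dpair q s w)
          = (\<Sum>w | mset w = mset s. (wordt hs w - (\<Sum>t\<in>T. c t * bval q t w)) * dpair q s w)"
        by (intro sum.cong) auto
      then show ?thesis using z by (simp add: nichols_zero_def)
    next
      case False
      have "wordt hs w - (\<Sum>t\<in>T'. c t * bval q t w) = 0" if "mset w = mset s" for w
      proof -
        have "(\<Sum>t\<in>T'. c t * bval q t w) = 0"
          unfolding T'_def using bval_support[of q _ w] that False by (intro sum.neutral) auto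
        then show ?thesis using that False by (auto simp: wordt_def)
      qed
      then show ?thesis by (intro sum.neutral) auto
    qed
  qed
  have hs: "mset hs \<noteq> {#}" "set_mset (mset hs) \<subseteq> {..<n}" using assms(2,3) by auto
  have "lie n q (mset hs) (\<lambda>w. \<Sum>t\<in>S. c t * bval q t w)" if "finite S" "S \<subseteq> T'" for S
    using that
  proof (induction S)
    case empty
    then show ?case using lie.null[OF nichols_zero_0 hs] by simp
  next
    case (insert t S)
    have "lie n q (mset hs) (bval q t)"
      using lie_bval[of t n q] insert.prems assms(3) by (auto simp: T'_def)
    from lie.lin[OF insert.IH this, of "c t"] show ?case
      using insert by (simp add: add.commute)
  qed
  then have "lie n q (mset hs) (\<lambda>w. \<Sum>t\<in>T'. c t * bval q t w)"
    using T(1) by (simp add: T'_def)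
  then show ?thesis
    using lie_nichols_cong[of q 1] zero by (simp add: nichols_cong_def)
qed

subsection \<open>Connected monomials\<close>

text \<open>Connectedness as a condition on cuts: this is what nonzero elements of L(V) supply, and
  a cut along the letters already used yields the next letter.\<close>

definition graph_connected :: "(nat \<Rightarrow> nat \<Rightarrow> 'a::field) \<Rightarrow> nat set \<Rightarrow> bool" where
  "graph_connected q S \<longleftrightarrow>
     (\<forall>X\<subseteq>S. X \<noteq> {} \<longrightarrow> X \<noteq> S \<longrightarrow> (\<exists>i\<in>X. \<exists>j\<in>S - X. q i j * q j i \<noteq> 1))"

lemma connected_mon_graph_connected:
  assumes "connected_mon n q hs"
  shows "graph_connected q (set hs)"
  unfolding graph_connected_def
proof (intro allI impI)
  fix X assume X: "X \<subseteq> set hs" "X \<noteq> {}" "X \<noteq> set hs"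
  then obtain i j where ij: "i \<in> X" "j \<in> set hs - X" by blast
  let ?E = "gamma_edges n q \<inter> (set hs \<times> set hs)"
  have "(i, j) \<in> ?E\<^sup>*" using assms ij X unfolding connected_mon_def by blast
  then have "j \<in> X \<or> (\<exists>i\<in>X. \<exists>j\<in>set hs - X. q i j * q j i \<noteq> 1)"
    by (induction rule: rtrancl_induct) (use ij in \<open>auto simp: gamma_edges_def\<close>)
  then show "\<exists>i\<in>X. \<exists>j\<in>set hs - X. q i j * q j i \<noteq> 1" using ij by blast
qed

lemma lie_graph_connected:
  assumes "lie n q A u" "\<not> nichols_zero q u"
  shows "graph_connected q (set_mset A)"
  unfolding graph_connected_def
proof (intro allI impI, rule ccontr)
  fix X assume X: "X \<subseteq> set_mset A" "X \<noteq> {}" "X \<noteq> set_mset A"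
    and "\<not> (\<exists>i\<in>X. \<exists>j\<in>set_mset A - X. q i j * q j i \<noteq> 1)"
  then have "q i j * q j i = 1" if "i \<in># A" "j \<in># A" "i \<in> X" "j \<notin> X" for i j
    using that by blast
  from lie_disconnected[OF assms(1), of X, OF this] show False
    using assms(2) X by blast
qed

lemma wordt_commute:
  assumes "\<not> adj q (mset u) (mset v)"
  shows "nichols_cong q (chi q (mset u) (mset v)) (wordt (x @ u @ v @ y)) (wordt (x @ v @ u @ y))"
  using nichols_cong_left[OF nichols_cong_right[OF homogeneous_commute[OF homogeneous_wordt homogeneous_wordt assms],
      of "wordt y"], of "wordt x"]
  by (simp add: wordt_mult)

text \<open>If a misses a letter of S, the cut at \<open>set a\<close> leads to a letter of b.
  Otherwise any letter y of b will do: it has a neighbour in S = \<open>set a\<close>, or S = {y}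
  and y is adjacent to itself.\<close>

lemma exists_adj_letter:
  assumes "graph_connected q S" "set a \<union> set b = S" "a \<noteq> []" "b \<noteq> []"
    and single: "\<And>y. S = {y} \<Longrightarrow> q y y * q y y \<noteq> 1"
  shows "\<exists>y\<in>set b. adj q (mset a) {#y#}"
proof (cases "set a = S")
  case False
  then have "\<exists>i\<in>set a. \<exists>j\<in>S - set a. q i j * q j i \<noteq> 1"
    using assms unfolding graph_connected_def by (metis Un_upper1 set_empty)
  then show ?thesis using assms(2) by (auto simp: adj_def)
next
  case True
  obtain y where y: "y \<in> set b" using assms(4) by (cases b) auto
  show ?thesis
  proof (cases "S = {y}")
    case True
    then show ?thesis using single y \<open>set a = S\<close> by (auto simp: adj_def)
  next
    case False
    then have "\<exists>i\<in>{y}. \<exists>j\<in>S - {y}. q i j * q j i \<noteq> 1"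
      using assms(1,2) y unfolding graph_connected_def by (metis Un_iff empty_subsetI insert_not_empty insert_subset)
    then obtain j where "j \<in> set a" "q j y * q y j \<noteq> 1"
      using \<open>set a = S\<close> by (auto simp: mult.commute)
    then show ?thesis
      using y by (auto simp: adj_def)
  qed
qed

context diagonal_braiding
begin

lemma chi_mset_nonzero: "set u \<subseteq> {..<n} \<Longrightarrow> set v \<subseteq> {..<n} \<Longrightarrow> chi q (mset u) (mset v) \<noteq> 0"
  by (rule chi_nonzero) simp_all

text \<open>The factor a absorbs an adjacent letter after the letters in between, none of
  which is adjacent to a, have been moved to the other side of a.\<close>
lemma grow_factor:
  assumes "lie n q (mset a) (wordt a)" "u @ v \<noteq> []" "set (u @ a @ v) = S" "S \<subseteq> {..<n}"
    "graph_connected q S" "\<And>y. S = {y} \<Longrightarrow> q y y * q y y \<noteq> 1"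
  shows "\<exists>b y hs c. lie n q (mset b) (wordt b) \<and> y < n \<and> adj q (mset b) {#y#} \<and> c \<noteq> 0 \<and>
    nichols_cong q c (wordt (u @ a @ v)) (wordt hs) \<and> mset hs = mset (u @ a @ v) \<and>
    (hs = b @ [y] \<or> hs = y # b)"
  using assms(1-3)
proof (induction "length (u @ v)" arbitrary: u a v rule: less_induct)
  case less
  have a: "a \<noteq> []" using lie_degree[OF less.prems(1)] by auto
  have step: ?case
    if y: "y \<in> set (u @ v)" and ay: "adj q (mset a) {#y#}"
      and mv: "nichols_cong q c (wordt (u @ a @ v)) (wordt (u' @ b @ v'))" "c \<noteq> 0"
      and b: "b = y # a \<or> b = a @ [y]" and ms: "mset (u' @ b @ v') = mset (u @ a @ v)" for y c u' b v'
  \<comment> \<open>The last remaining letter is not absorbed but kept apart, since the pair of a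
    and y is the decomposition sought.\<close>
  proof (cases "u' @ v' = []")
    case True
    have "y < n" using y less.prems(3) assms(4) by auto
    then show ?thesis
      using mv b ms less.prems(1) ay True by (intro exI[of _ a] exI[of _ y] exI[of _ b] exI[of _ c]) auto
  next
    case False
    have "lie n q (mset [y]) (wordt [y])"
      using y less.prems(3) assms(4) by (auto intro: lie.letter)
    then have "lie n q (mset b) (wordt b)"
      using lie_mult[OF _ less.prems(1)] lie_mult[OF less.prems(1)] ay b
      by (fastforce simp: wordt_mult adj_commute)
    moreover have "length (u' @ b @ v') = length (u @ a @ v)" using ms by (rule mset_eq_length)
    then have "length (u' @ v') < length (u @ v)" using b by auto
    moreover have "set (u' @ b @ v') = S" using mset_eq_setD[OF ms] less.prems(3) by simp
    ultimately obtain b' y' hs c' where "lie n q (mset b') (wordt b')" "y' < n" "adj q (mset b') {#y'#}" "c' \<noteq> 0"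
      "nichols_cong q c' (wordt (u' @ b @ v')) (wordt hs)" "mset hs = mset (u' @ b @ v')"
      "hs = b' @ [y'] \<or> hs = y' # b'"
      using less.hyps[of u' v' b] False by blast
    then show ?thesis
      using nichols_cong_trans[OF mv(1)] mv(2) ms
      by (intro exI[of _ b'] exI[of _ y'] exI[of _ hs] exI[of _ "c * c'"]) auto
  qed
  show ?case
  proof (cases "\<exists>z\<in>set u. adj q (mset a) {#z#}")
    case True
    \<comment> \<open>The adjacent letter of u closest to a is chosen; the letters u2 between them
      commute with a up to a scalar and move to its right.\<close>
    from split_list_last_prop[OF this] obtain u1 z u2
      where u: "u = u1 @ z # u2" and az: "adj q (mset a) {#z#}" and "\<forall>x\<in>set u2. \<not> adj q (mset a) {#x#}"
      by blast
    then have "\<not> adj q (mset u2) (mset a)" by (auto simp: adj_def mult.commute)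
    from wordt_commute[OF this, of "u1 @ [z]" v] show ?thesis
      using az u less.prems(3) assms(4)
      by (intro step[of z "chi q (mset u2) (mset a)" u1 "z # a" "u2 @ v"] chi_mset_nonzero) auto
  next
    case False
    obtain y where "y \<in> set (u @ v)" "adj q (mset a) {#y#}"
      using exists_adj_letter[OF assms(5) _ a less.prems(2) assms(6)] less.prems(3) by auto
    with False have "\<exists>z\<in>set v. adj q (mset a) {#z#}" by auto
    from split_list_first_prop[OF this] obtain v1 z v2
      where v: "v = v1 @ z # v2" and az: "adj q (mset a) {#z#}" and "\<forall>x\<in>set v1. \<not> adj q (mset a) {#x#}"
      by blast
    then have "\<not> adj q (mset a) (mset v1)" by (auto simp: adj_def)
    from wordt_commute[OF this, of u "z # v2"] show ?thesis
      using az v less.prems(3) assms(4)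
      by (intro step[of z "chi q (mset a) (mset v1)" "u @ v1" "a @ [z]" v2] chi_mset_nonzero) auto
  qed
qed

end


text \<open>Here q_yy = -1, and the commutation of x_y with itself reads (1 - q_yy) x_y^2 = 0 with
  an invertible scalar.\<close>

lemma nichols_zero_power:
  assumes "length hs \<ge> 2" "set hs = {y}" "q y y * q y y = 1" "q y y \<noteq> 1"
  shows "nichols_zero q (wordt hs)"
proof -
  obtain i j r where "hs = i # j # r"
    using assms(1) by (auto simp: numeral_2_eq_2 Suc_le_length_iff)
  then have hs: "hs = [y, y] @ r" using assms(2) by auto
  have "nichols_zero q (\<lambda>w. wordt [y, y] w - q y y * wordt [y, y] w)"
    using letters_commute[of q y y] assms(3) by (simp add: nichols_cong_def wordt_mult)
  from nichols_zero_scale[OF this, of "inverse (1 - q y y)"]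
  have "nichols_zero q (\<lambda>w. inverse (1 - q y y) * ((1 - q y y) * wordt [y, y] w))"
    by (simp add: algebra_simps)
  moreover have "(\<lambda>w. inverse (1 - q y y) * ((1 - q y y) * wordt [y, y] w)) = wordt [y, y]"
    using assms(4) by (simp add: fun_eq_iff)
  ultimately have "nichols_zero q (wordt [y, y])" by simp
  then show ?thesis
    using nichols_zero_tmult[of q "wordt [y, y]" "wordt r"] unfolding hs by (simp add: wordt_mult)
qed

section \<open>The three assertions on monomials\<close>

theorem theorem2p4:
  fixes n m :: nat and q :: "nat \<Rightarrow> nat \<Rightarrow> 'a::{alg_closed_field, field_char_0}"
    and hs :: "nat list"
  assumes q_nz: "\<And>i j. i < n \<Longrightarrow> j < n \<Longrightarrow> q i j \<noteq> 0"
    and m: "m \<ge> 2" and len: "length hs = m" and letters: "set hs \<subseteq> {..<n}"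
    and single: "set hs = {hs ! 0} \<Longrightarrow> q (hs ! 0) (hs ! 0) \<noteq> 1"
  shows
    "((in_L n q (wordt (butlast hs)) \<and> diam q (butlast hs) [last hs]) \<or>
      (in_L n q (wordt (tl hs)) \<and> diam q (tl hs) [hd hs])
        \<longrightarrow> in_L n q (wordt hs))
     \<and>
     (\<not> nichols_zero q (wordt hs) \<and> in_L n q (wordt hs) \<longrightarrow>
        (\<exists>\<tau>. \<tau> permutes {..<m} \<and>
           (let hs' = map (\<lambda>k. hs ! \<tau> k) [0..<m] in
              nsim q (wordt hs) (wordt hs') \<and>
              ((\<not> nichols_zero q (wordt (butlast hs')) \<and> in_L n q (wordt (butlast hs'))
                  \<and> diam q (butlast hs') [last hs']) \<or>
               (\<not> nichols_zero q (wordt (tl hs')) \<and> in_L n q (wordt (tl hs'))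
                  \<and> diam q (tl hs') [hd hs'])))))
     \<and>
     (connected_mon n q hs \<longrightarrow> in_L n q (wordt hs))"
proof -
  interpret diagonal_braiding n q by unfold_locales (rule q_nz)
  have diam: "diam q u v \<longleftrightarrow> adj q (mset u) (mset v)" for u v
    by (simp add: diam_def adj_def)
  have letter: "lie n q (mset [i]) (wordt [i])" if "i \<in> set hs" for i
    using that letters by (auto intro: lie.letter)
  have hs: "butlast hs \<noteq> []" "tl hs \<noteq> []" "hs \<noteq> []"
    using m len by (auto simp flip: length_greater_0_conv)
  have grow: "\<exists>b y hs' c. lie n q (mset b) (wordt b) \<and> y < n \<and> adj q (mset b) {#y#} \<and> c \<noteq> 0 \<and>
      nichols_cong q c (wordt hs) (wordt hs') \<and> mset hs' = mset hs \<and> (hs' = b @ [y] \<or> hs' = y # b)"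
    if nz: "\<not> nichols_zero q (wordt hs)" and conn: "graph_connected q (set hs)"
  proof -
    \<comment> \<open>For a power of one letter, q_yy^2 = 1 together with \<open>single\<close>
      would make the monomial vanish, against \<open>nz\<close>.\<close>
    have sq: "q y y * q y y \<noteq> 1" if "set hs = {y}" for y
    proof -
      have "hs ! 0 = y" using that hs(3) nth_mem[of 0 hs] by simp
      then show ?thesis using nichols_zero_power[of hs y] nz single that m len by auto
    qed
    have eq: "[] @ [hd hs] @ tl hs = hs" using hs by simp
    show ?thesis
      by (rule grow_factor[of "[hd hs]" "[]" "tl hs" "set hs", unfolded eq])
        (use letter[of "hd hs"] letters conn hs sq in auto)
  qed
  have a: "in_L n q (wordt hs)"
    if "in_L n q (wordt (butlast hs)) \<and> diam q (butlast hs) [last hs] \<or>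
      in_L n q (wordt (tl hs)) \<and> diam q (tl hs) [hd hs]"
    using that
  proof (elim disjE conjE)
    assume *: "in_L n q (wordt (butlast hs))" "diam q (butlast hs) [last hs]"
    have "set (butlast hs) \<subseteq> {..<n}" using letters by (auto dest: in_set_butlastD)
    from lie_mult[OF in_L_wordt_lie[OF *(1) hs(1) this] letter[of "last hs"]] *(2)
    have "lie n q (mset (butlast hs) + mset [last hs]) (wordt (butlast hs) \<cdot> wordt [last hs])"
      using hs unfolding diam by simp
    from lie_in_L[OF this] show ?thesis using hs by (simp add: wordt_mult)
  next
    assume *: "in_L n q (wordt (tl hs))" "diam q (tl hs) [hd hs]"
    have "set (tl hs) \<subseteq> {..<n}" using letters list.set_sel(2)[OF hs(3)] by auto
    from lie_mult[OF letter[of "hd hs"] in_L_wordt_lie[OF *(1) hs(2) this]] *(2)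
    have "lie n q (mset [hd hs] + mset (tl hs)) (wordt [hd hs] \<cdot> wordt (tl hs))"
      using hs unfolding diam by (simp add: adj_commute)
    from lie_in_L[OF this] show ?thesis using hs by (simp add: wordt_mult)
  qed
  have b: "\<exists>\<tau>. \<tau> permutes {..<m} \<and>
           (let hs' = map (\<lambda>k. hs ! \<tau> k) [0..<m] in
              nsim q (wordt hs) (wordt hs') \<and>
              ((\<not> nichols_zero q (wordt (butlast hs')) \<and> in_L n q (wordt (butlast hs'))
                  \<and> diam q (butlast hs') [last hs']) \<or>
               (\<not> nichols_zero q (wordt (tl hs')) \<and> in_L n q (wordt (tl hs'))
                  \<and> diam q (tl hs') [hd hs'])))"
    if nz: "\<not> nichols_zero q (wordt hs)" and L: "in_L n q (wordt hs)"
  proof -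
    have "graph_connected q (set hs)"
      using lie_graph_connected[OF in_L_wordt_lie[OF L hs(3) letters] nz] by simp
    from grow[OF nz this] obtain b y hs' c where b: "lie n q (mset b) (wordt b)" "adj q (mset b) {#y#}"
      and c: "c \<noteq> 0" "nichols_cong q c (wordt hs) (wordt hs')" and ms: "mset hs' = mset hs"
      and hs': "hs' = b @ [y] \<or> hs' = y # b" by blast
    obtain \<tau> where \<tau>: "\<tau> permutes {..<length hs}" "permute_list \<tau> hs = hs'"
      using mset_eq_permutation[OF ms] by blast
    have map: "map (\<lambda>k. hs ! \<tau> k) [0..<m] = hs'"
      using \<tau>(2) len by (simp add: permute_list_def)
    have "nsim q (wordt hs) (wordt hs')"
      using c by (auto simp: nsim_def nichols_cong_def)
    moreover have "\<not> nichols_zero q (wordt b)"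
    proof
      assume "nichols_zero q (wordt b)"
      then have "nichols_zero q (wordt hs')"
        using hs' nichols_zero_tmult[of q "wordt b" "wordt [y]"] nichols_zero_tmult[of q "wordt [y]" "wordt b"]
        by (auto simp: wordt_mult)
      then show False using nichols_zero_cong[OF c(2)] nz by blast
    qed
    ultimately show ?thesis
      using \<tau>(1) len lie_in_L[OF b(1)] b(2) hs'
      by (intro exI[of _ \<tau>]) (auto simp: map diam)
  qed
  have c: "in_L n q (wordt hs)" if "connected_mon n q hs"
  \<comment> \<open>A null monomial lies in L(V) trivially. Separating it excludes powers of a
    letter with q_yy = -1, to which \<open>grow\<close> would not apply.\<close>
  proof (cases "nichols_zero q (wordt hs)")
    case True
    then show ?thesis using lie_in_L[OF lie.null[of q _ "mset hs" n]] letters hs by simp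
  next
    case False
    from grow[OF this connected_mon_graph_connected[OF that]]
    obtain b y hs' c where b: "lie n q (mset b) (wordt b)" "y < n" "adj q (mset b) {#y#}"
      and c: "nichols_cong q c (wordt hs) (wordt hs')" and hs': "hs' = b @ [y] \<or> hs' = y # b" by blast
    have y: "lie n q {#y#} (wordt [y])" using b(2) by (rule lie.letter)
    have "lie n q (mset hs') (wordt hs')"
      using hs' lie_mult[OF b(1) y b(3)] lie_mult[OF y b(1)] b(3)
      by (auto simp: wordt_mult adj_commute)
    then show ?thesis using lie_nichols_cong[OF c] lie_in_L by blast
  qed
  show ?thesis using a b c by blast
qed

end
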